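(* Let $n\ge5$. The graded Betti numbers in the linear strand of $S_{G_n}/J_{G_n}$ are given by $$\beta_{i,i+1}(S_{G_n}/J_{G_n})=\begin{cases} n(n-2), & i=1,\\ 0, & i\ge2.\end{cases}$$
   Context: Graph $G_n$: let $X=\{u_0,\dots,u_{n-1}\}$ and $Y=\{v_0,\dots,v_{n-1}\}$ be disjoint, indices modulo $n$. $G_n$ is the bipartite graph on $X\sqcup Y$ with $\{u_i,v_j\}\in E(G_n)$ iff $j\notin\{i,i-1\}$ modulo $n$ (the bipartite complement of the cycle $C_{2n}$ with edges $\{u_i,v_i\},\{u_i,v_{i-1}\}$). Binomial edge ideal: let $\mathbb K$ be an arbitrary field. For a finite simple graph $G$, $S_G=\mathbb K[x_w,y_w:w\in V(G)]$ (standard graded) and $J_G\subseteq S_G$ is the ideal generated by $x_ay_b-x_by_a$ for all edges $\{a,b\}\in E(G)$. $\beta_{i,j}(R)$ denotes the graded Betti number of $R=S_G/J_G$ over $S_G$: the number of summands $S_G(-j)$ in homological degree $i$ of the minimal graded free resolution of $R$. *)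

theory Defs
  imports "HOL-Library.Poly_Mapping"
begin

section \<open>Polynomials\<close>

text \<open>Polynomials with variables from the type \<open>'x\<close> and coefficients in \<open>'k\<close>: finitely
  supported functions from exponent vectors to coefficients, with the convolution product of
  \<^theory>\<open>HOL-Library.Poly_Mapping\<close>.\<close>

type_synonym ('x, 'k) mpoly = "('x \<Rightarrow>\<^sub>0 nat) \<Rightarrow>\<^sub>0 'k"

definition var :: "'x \<Rightarrow> ('x, 'k::field) mpoly"
  where "var x = Poly_Mapping.single (Poly_Mapping.single x 1) 1"

definition mdeg :: "('x \<Rightarrow>\<^sub>0 nat) \<Rightarrow> nat"
  where "mdeg m = (\<Sum>x\<in>Poly_Mapping.keys m. Poly_Mapping.lookup m x)"

text \<open>The type of variables may be infinite; the polynomial ring in a finite set \<open>X\<close> of variables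
  is a subset of \<open>('x, 'k) mpoly\<close>.\<close>

definition poly_ring :: "'x set \<Rightarrow> ('x, 'k::field) mpoly set"
  where "poly_ring X = {p. \<forall>m\<in>Poly_Mapping.keys p. Poly_Mapping.keys m \<subseteq> X}"

lemma poly_ring_zero: "0 \<in> poly_ring X"
  by (simp add: poly_ring_def)

lemma poly_ring_one: "1 \<in> poly_ring X"
  by (simp add: poly_ring_def)

lemma poly_ring_uminus: "p \<in> poly_ring X \<Longrightarrow> - p \<in> poly_ring X"
  by (simp add: poly_ring_def)

lemma poly_ring_add: "p \<in> poly_ring X \<Longrightarrow> q \<in> poly_ring X \<Longrightarrow> p + q \<in> poly_ring X"
  unfolding poly_ring_def using Poly_Mapping.keys_add[of p q] by blast

lemma poly_ring_mult:
  assumes "p \<in> poly_ring X" "q \<in> poly_ring X"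
  shows "p * q \<in> poly_ring X"
  unfolding poly_ring_def
proof (intro CollectI ballI)
  fix m assume "m \<in> Poly_Mapping.keys (p * q)"
  then obtain a b where "m = a + b" "a \<in> Poly_Mapping.keys p" "b \<in> Poly_Mapping.keys q"
    using keys_mult[of p q] by blast
  then show "Poly_Mapping.keys m \<subseteq> X"
    using assms Poly_Mapping.keys_add[of a b] unfolding poly_ring_def by blast
qed

definition irrelevant_ideal :: "'x set \<Rightarrow> ('x, 'k::field) mpoly set"
  where "irrelevant_ideal X = {p \<in> poly_ring X. Poly_Mapping.lookup p 0 = 0}"

text \<open>Degrees are integers, so that the entry of a degree-preserving map \<open>S(-b) \<rightarrow> S(-a)\<close> can be
  described as homogeneous of degree \<open>b - a\<close>; for a negative degree this forces the entry to
  be zero.\<close>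

definition homogeneous :: "int \<Rightarrow> ('x, 'k::field) mpoly \<Rightarrow> bool"
  where "homogeneous e p \<longleftrightarrow> (\<forall>m\<in>Poly_Mapping.keys p. int (mdeg m) = e)"

definition ideal_gen :: "'x set \<Rightarrow> ('x, 'k::field) mpoly set \<Rightarrow> ('x, 'k) mpoly set"
  where "ideal_gen X B =
    {(\<Sum>b\<in>A. c b * b) | A c. finite A \<and> A \<subseteq> B \<and> (\<forall>b\<in>A. c b \<in> poly_ring X)}"


section \<open>Minimal graded free resolutions of \<open>S/J\<close>\<close>

text \<open>
  Here \<open>S = poly_ring X\<close>. The record describes
  \<open>\<dots> \<rightarrow> F_2 \<rightarrow> F_1 \<rightarrow> F_0 \<rightarrow> S/J \<rightarrow> 0\<close>, where \<open>F_i\<close> is the direct sum of the \<open>S(- shift i k)\<close> for \<open>k < rk i\<close>.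
  Elements of \<open>F_i\<close> are coordinate vectors indexed by the natural numbers below \<open>rk i\<close>.
  The map \<open>F_0 \<rightarrow> S/J\<close> sends the basis element \<open>k\<close> to the class of \<open>aug k\<close>.
  For \<open>i \<ge> 1\<close>, \<open>diff i k l\<close> is the entry in row \<open>k\<close> and column \<open>l\<close> of the matrix of
  \<open>F_i \<rightarrow> F_{i-1}\<close>; \<open>diff 0\<close> is unused.
\<close>

record 'p free_complex_data =
  rk :: "nat \<Rightarrow> nat"
  shift :: "nat \<Rightarrow> nat \<Rightarrow> int"
  aug :: "nat \<Rightarrow> 'p"
  diff :: "nat \<Rightarrow> nat \<Rightarrow> nat \<Rightarrow> 'p"

type_synonym ('x, 'k) free_complex = "('x, 'k) mpoly free_complex_data"

definition free_mod :: "'x set \<Rightarrow> nat \<Rightarrow> (nat \<Rightarrow> ('x, 'k::field) mpoly) set"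
  where "free_mod X r = {f. (\<forall>k<r. f k \<in> poly_ring X) \<and> (\<forall>k\<ge>r. f k = 0)}"

abbreviation chain_mod :: "'x set \<Rightarrow> ('x, 'k::field) free_complex \<Rightarrow> nat
    \<Rightarrow> (nat \<Rightarrow> ('x, 'k) mpoly) set"
  where "chain_mod X F i \<equiv> free_mod X (rk F i)"

definition aug_map :: "('x, 'k::field) free_complex \<Rightarrow> (nat \<Rightarrow> ('x, 'k) mpoly) \<Rightarrow> ('x, 'k) mpoly"
  where "aug_map F f = (\<Sum>k<rk F 0. aug F k * f k)"

definition diff_map :: "('x, 'k::field) free_complex \<Rightarrow> nat
    \<Rightarrow> (nat \<Rightarrow> ('x, 'k) mpoly) \<Rightarrow> (nat \<Rightarrow> ('x, 'k) mpoly)"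
  where "diff_map F i f =
    (\<lambda>k. if k < rk F (i - 1) then (\<Sum>l<rk F i. diff F i k l * f l) else 0)"

definition graded_free_complex :: "'x set \<Rightarrow> ('x, 'k::field) free_complex \<Rightarrow> bool"
  where "graded_free_complex X F \<longleftrightarrow>
    (\<forall>k<rk F 0. aug F k \<in> poly_ring X \<and> homogeneous (shift F 0 k) (aug F k)) \<and>
    (\<forall>i\<ge>1. \<forall>k<rk F (i - 1). \<forall>l<rk F i.
        diff F i k l \<in> poly_ring X \<and>
        homogeneous (shift F i l - shift F (i - 1) k) (diff F i k l))"

text \<open>The three conjuncts after gradedness are exactness at \<open>S/J\<close>, at \<open>F_0\<close>, and at \<open>F_i\<close>
  for \<open>i \<ge> 1\<close>.\<close>

definition graded_free_resolution ::
    "'x set \<Rightarrow> ('x, 'k::field) mpoly set \<Rightarrow> ('x, 'k) free_complex \<Rightarrow> bool"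
  where "graded_free_resolution X J F \<longleftrightarrow>
    graded_free_complex X F \<and>
    (\<forall>s\<in>poly_ring X. \<exists>f\<in>chain_mod X F 0. s - aug_map F f \<in> J) \<and>
    {f \<in> chain_mod X F 0. aug_map F f \<in> J} = diff_map F 1 ` chain_mod X F 1 \<and>
    (\<forall>i\<ge>1. {f \<in> chain_mod X F i. diff_map F i f = (\<lambda>_. 0)}
              = diff_map F (i + 1) ` chain_mod X F (i + 1))"

text \<open>Minimality: the image of \<open>F_i \<rightarrow> F_{i-1}\<close> lies in the irrelevant ideal times \<open>F_{i-1}\<close>,
  which consists of the vectors with all coordinates in the irrelevant ideal.\<close>

definition minimal_graded_free_resolution ::
    "'x set \<Rightarrow> ('x, 'k::field) mpoly set \<Rightarrow> ('x, 'k) free_complex \<Rightarrow> bool"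
  where "minimal_graded_free_resolution X J F \<longleftrightarrow>
    graded_free_resolution X J F \<and>
    (\<forall>i\<ge>1. \<forall>f\<in>chain_mod X F i. \<forall>k<rk F (i - 1). diff_map F i f k \<in> irrelevant_ideal X)"

text \<open>The description determines a number because minimal graded free resolutions of \<open>S/J\<close> exist
  and are unique up to isomorphism when \<open>X\<close> is finite and \<open>J\<close> is a homogeneous ideal.\<close>

definition graded_betti :: "'x set \<Rightarrow> ('x, 'k::field) mpoly set \<Rightarrow> nat \<Rightarrow> int \<Rightarrow> nat"
  where "graded_betti X J i j =
    (THE b. \<exists>F. minimal_graded_free_resolution X J F \<and>
                b = card {k. k < rk F i \<and> shift F i k = j})"


section \<open>Binomial edge ideals\<close>

text \<open>A simple graph is a pair of a vertex set and a set of two-element edges.\<close>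

type_synonym 'v graph = "'v set \<times> 'v set set"

definition finite_simple_graph :: "'v graph \<Rightarrow> bool"
  where "finite_simple_graph G \<longleftrightarrow>
    finite (fst G) \<and> (\<forall>e\<in>snd G. e \<subseteq> fst G \<and> card e = 2)"

datatype 'v xy = XVar 'v | YVar 'v

definition edge_vars :: "'v graph \<Rightarrow> 'v xy set"
  where "edge_vars G = XVar ` fst G \<union> YVar ` fst G"

definition binomial_edge_ideal :: "'v graph \<Rightarrow> ('v xy, 'k::field) mpoly set"
  where "binomial_edge_ideal G =
    ideal_gen (edge_vars G)
      {var (XVar a) * var (YVar b) - var (XVar b) * var (YVar a) | a b. {a, b} \<in> snd G}"

text \<open>\<open>betti TYPE('k) G i j\<close> is the graded Betti number of \<open>S_G/J_G\<close> over the field \<open>'k\<close>.\<close>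

definition betti :: "'k::field itself \<Rightarrow> 'v graph \<Rightarrow> nat \<Rightarrow> int \<Rightarrow> nat"
  where "betti _ G i j =
    graded_betti (edge_vars G) (binomial_edge_ideal G :: ('v xy, 'k) mpoly set) i j"


section \<open>The bipartite complement of the cycle of length \<open>2n\<close>\<close>

datatype bvertex = U nat | V nat

definition Gn :: "nat \<Rightarrow> bvertex graph"
  where "Gn n =
    (U ` {..<n} \<union> V ` {..<n},
     {{U i, V j} | i j. i < n \<and> j < n \<and> j \<noteq> i \<and> int j \<noteq> (int i - 1) mod int n})"

lemma finite_simple_graph_Gn: "finite_simple_graph (Gn n)"
  by (auto simp: finite_simple_graph_def Gn_def)

end

theory Submission
  imports Defs "HOL-Computational_Algebra.Primes" "HOL.Vector_Spaces"
begin

text \<open>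
  The edges of \<open>G\<^sub>n\<close> join \<open>X\<close> to \<open>Y\<close>, so \<open>G\<^sub>n\<close> contains no triangle, and for every triangle-free graph
  the linear strand of \<open>S/J\<close> consists of the edge binomials alone.

  The reason is a remark on monomials. Write \<open>f\<^sub>e = x\<^sub>a y\<^sub>b - x\<^sub>b y\<^sub>a\<close> for an edge \<open>e = {a, b}\<close>, and let \<open>w\<close> be
  any vertex. Not both endpoints of \<open>e\<close> are adjacent to \<open>w\<close>, because there is no triangle (and if \<open>w\<close>
  lies on \<open>e\<close>, it is not adjacent to itself). Say \<open>a\<close> is not adjacent to \<open>w\<close>. Then \<open>x\<^sub>w x\<^sub>b y\<^sub>a\<close> is divisible by
  \<open>x\<^sub>p y\<^sub>q\<close> for an edge \<open>{p, q}\<close> only if \<open>(p, q) = (b, a)\<close>, so among all products of a variable with an edge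
  binomial this monomial occurs in \<open>x\<^sub>w f\<^sub>e\<close> alone; likewise \<open>y\<^sub>w x\<^sub>a y\<^sub>b\<close> occurs only in \<open>y\<^sub>w f\<^sub>e\<close>. Hence these
  products are linearly independent over the field, whatever it is: there are no linear syzygies
  (\<open>no_linear_syzygies\<close>).

  Now let \<open>F\<close> be any minimal graded free resolution of \<open>S/J\<close>. Then \<open>F\<^sub>0 = S\<close>, and the generators of degree 2
  of \<open>F\<^sub>1\<close> map to a basis of the quadrics in \<open>J\<close>, so there are as many of them as edges. A generator of
  degree 3 of \<open>F\<^sub>2\<close> would be a linear syzygy, so \<open>F\<^sub>2\<close> is generated in degrees at least 4. By minimality
  the least degree of a generator grows in every step, so \<open>F\<^sub>i\<close> is generated in degrees at least \<open>i + 2\<close> for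
  \<open>i \<ge> 2\<close> (\<open>linear_strand\<close> in the locale \<open>quadric_ideal_resolution\<close>).

  The graded Betti number is a definite description, so this determines it only once some
  minimal graded free resolution is known to exist (\<open>minimal_resolution_exists\<close>). It is built step by step,
  by covering the kernel of the last map with the smallest possible number of homogeneous
  generators; smallest number forces minimality. That finitely many suffice is Hilbert's basis
  theorem for submodules of free modules (\<open>hilbert_basis\<close>), proved with leading monomials and Dickson's
  lemma.
\<close>
section \<open>Degrees and homogeneous parts\<close>

abbreviation coef :: "('x, 'k::field) mpoly \<Rightarrow> ('x \<Rightarrow>\<^sub>0 nat) \<Rightarrow> 'k"
  where "coef \<equiv> Poly_Mapping.lookup"

abbreviation supp :: "('x, 'k::field) mpoly \<Rightarrow> ('x \<Rightarrow>\<^sub>0 nat) set"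
  where "supp \<equiv> Poly_Mapping.keys"

abbreviation cst :: "'k::field \<Rightarrow> ('x, 'k) mpoly"
  where "cst a \<equiv> Poly_Mapping.single 0 a"

lemma mdeg_superset:
  assumes "finite A" "Poly_Mapping.keys m \<subseteq> A"
  shows "mdeg m = (\<Sum>x\<in>A. Poly_Mapping.lookup m x)"
  unfolding mdeg_def using assms
  by (intro sum.mono_neutral_left) (auto simp: in_keys_iff)

lemma mdeg_add: "mdeg (m + m') = mdeg m + mdeg m'"
proof -
  let ?A = "Poly_Mapping.keys m \<union> Poly_Mapping.keys m'"
  have "mdeg (m + m') = (\<Sum>x\<in>?A. Poly_Mapping.lookup (m + m') x)"
    using Poly_Mapping.keys_add[of m m'] by (intro mdeg_superset) auto
  also have "\<dots> = mdeg m + mdeg m'"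
    by (simp add: mdeg_superset[of ?A m] mdeg_superset[of ?A m'] lookup_add sum.distrib)
  finally show ?thesis .
qed

lemma mdeg_zero [simp]: "mdeg 0 = 0"
  by (simp add: mdeg_def)

lemma mdeg_eq_0_iff: "mdeg m = 0 \<longleftrightarrow> m = 0"
proof
  assume "mdeg m = 0"
  then have "\<And>x. x \<in> Poly_Mapping.keys m \<Longrightarrow> Poly_Mapping.lookup m x = 0"
    by (simp add: mdeg_def)
  then show "m = 0"
    by (intro poly_mapping_eqI) (metis in_keys_iff lookup_zero)
qed simp

lemma mdeg_single [simp]: "mdeg (Poly_Mapping.single x e) = e"
  by (simp add: mdeg_def)

lemma coef_cst_mult [simp]: "coef (cst a * p) m = a * coef p m"
  by (simp flip: mult_map_scale_conv_mult add: Poly_Mapping.map.rep_eq when_def)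

lemma cst_in_poly_ring: "cst a \<in> poly_ring X"
  by (simp add: poly_ring_def)

lemma poly_ring_diff: "p \<in> poly_ring X \<Longrightarrow> q \<in> poly_ring X \<Longrightarrow> p - q \<in> poly_ring X"
  using poly_ring_add[of p X "- q"] by (simp add: poly_ring_uminus)

lemma poly_ring_sum: "(\<And>i. i \<in> A \<Longrightarrow> p i \<in> poly_ring X) \<Longrightarrow> sum p A \<in> poly_ring X"
  by (induction A rule: infinite_finite_induct) (auto simp: poly_ring_zero poly_ring_add)

lemma supp_nonempty: "p \<noteq> 0 \<Longrightarrow> \<exists>m. m \<in> supp p"
  by (rule ccontr) (simp flip: ex_in_conv)

lemma homogeneous_zero [simp]: "homogeneous e 0"
  by (simp add: homogeneous_def)

lemma homogeneous_cst [simp]: "homogeneous 0 (cst a)"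
  by (simp add: homogeneous_def)

lemma homogeneous_uminus: "homogeneous e p \<Longrightarrow> homogeneous e (- p)"
  by (simp add: homogeneous_def)

lemma homogeneous_add: "homogeneous e p \<Longrightarrow> homogeneous e q \<Longrightarrow> homogeneous e (p + q)"
  using Poly_Mapping.keys_add[of p q] by (auto simp: homogeneous_def)

lemma homogeneous_mult:
  assumes "homogeneous d p" "homogeneous e q" shows "homogeneous (d + e) (p * q)"
  unfolding homogeneous_def
proof
  fix m assume "m \<in> supp (p * q)"
  then obtain a b where "m = a + b" "a \<in> supp p" "b \<in> supp q"
    using keys_mult[of p q] by blast
  with assms show "int (mdeg m) = d + e"
    by (simp add: homogeneous_def mdeg_add)
qed

lemma homogeneous_negative: "homogeneous e p \<Longrightarrow> e < 0 \<Longrightarrow> p = 0"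
  using supp_nonempty[of p] unfolding homogeneous_def by fastforce

lemma homogeneous_nonpos:
  assumes "homogeneous e p" "e \<le> 0" shows "p = cst (coef p 0)"
proof (rule poly_mapping_eqI)
  fix m show "coef p m = coef (cst (coef p 0)) m"
  proof (cases "m = 0")
    case False
    then have "mdeg m > 0"
      by (metis mdeg_eq_0_iff gr0I)
    with assms have "m \<notin> supp p"
      by (force simp: homogeneous_def)
    with False show ?thesis
      by (simp add: in_keys_iff lookup_single)
  qed simp
qed

lemma homogeneous_coef_0: "homogeneous e p \<Longrightarrow> e \<noteq> 0 \<Longrightarrow> coef p 0 = 0"
  by (force simp: homogeneous_def in_keys_iff)

text \<open>Taking the constant coefficient is evaluation at the origin. Split off both constant terms: only a
  product of two constant monomials is constant, because degrees add.\<close>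

lemma coef_mult_0: "coef (p * q) 0 = coef p 0 * coef q (0 :: 'x \<Rightarrow>\<^sub>0 nat)"
proof -
  have *: "a = 0 \<and> b = 0" if "0 = a + b" for a b :: "'x \<Rightarrow>\<^sub>0 nat"
  proof -
    have "mdeg a + mdeg b = 0"
      by (metis that mdeg_add mdeg_zero)
    then show ?thesis
      by (simp add: mdeg_eq_0_iff)
  qed
  define p' q' where "p' = p - cst (coef p 0)" and "q' = q - cst (coef q 0)"
  have 0: "coef p' 0 = 0" "coef q' 0 = 0"
    by (auto simp: p'_def q'_def lookup_minus)
  have "0 \<notin> supp (p' * q')"
  proof
    assume "0 \<in> supp (p' * q')"
    then obtain a b where "0 = a + b" "a \<in> supp p'" "b \<in> supp q'"
      using keys_mult[of p' q'] by blast
    with * 0 show False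
      by (metis in_keys_iff)
  qed
  moreover have "p = cst (coef p 0) + p'" "q = cst (coef q 0) + q'"
    by (auto simp: p'_def q'_def)
  then have "p * q = (cst (coef p 0) + p') * (cst (coef q 0) + q')"
    by simp
  then have "p * q = cst (coef p 0) * cst (coef q 0) + cst (coef p 0) * q' + cst (coef q 0) * p' + p' * q'"
    by (simp add: algebra_simps)
  ultimately show ?thesis
    by (simp add: lookup_add 0 in_keys_iff)
qed

definition hpart :: "int \<Rightarrow> ('x, 'k::field) mpoly \<Rightarrow> ('x, 'k) mpoly"
  where "hpart e p = Poly_Mapping.mapp (\<lambda>m a. if int (mdeg m) = e then a else 0) p"

lemma coef_hpart: "coef (hpart e p) m = (if int (mdeg m) = e then coef p m else 0)"
  by (simp add: hpart_def lookup_mapp when_def in_keys_iff)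

lemma supp_hpart: "supp (hpart e p) = {m \<in> supp p. int (mdeg m) = e}"
  by (auto simp: in_keys_iff coef_hpart split: if_splits)

lemma homogeneous_hpart: "homogeneous e (hpart e p)"
  by (simp add: homogeneous_def supp_hpart)

lemma hpart_in_poly_ring: "p \<in> poly_ring X \<Longrightarrow> hpart e p \<in> poly_ring X"
  by (simp add: poly_ring_def supp_hpart)

lemma hpart_zero [simp]: "hpart e 0 = 0"
  by (rule poly_mapping_eqI) (simp add: coef_hpart)

lemma hpart_add: "hpart e (p + q) = hpart e p + hpart e q"
  by (rule poly_mapping_eqI) (simp add: coef_hpart lookup_add)

lemma hpart_sum: "hpart e (sum p A) = (\<Sum>i\<in>A. hpart e (p i))"
  by (induction A rule: infinite_finite_induct) (auto simp: hpart_add)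

lemma hpart_homogeneous: "homogeneous e p \<Longrightarrow> hpart e p = p"
  by (rule poly_mapping_eqI) (auto simp: coef_hpart homogeneous_def in_keys_iff)

text \<open>Multiplication by a homogeneous polynomial of degree \<open>d\<close> shifts the grading by \<open>d\<close>: split \<open>q\<close> into its
  part of degree \<open>e - d\<close> and the rest, and the product with the rest has no term of degree \<open>e\<close>.\<close>

lemma hpart_mult:
  assumes "homogeneous d p" shows "hpart e (p * q) = p * hpart (e - d) q"
proof -
  let ?q = "hpart (e - d) q"
  have "hpart e (p * ?q) = p * ?q"
    using homogeneous_mult[OF assms homogeneous_hpart[of "e - d" q]] by (simp add: hpart_homogeneous)
  moreover have "hpart e (p * (q - ?q)) = 0"
  proof -
    have "int (mdeg m) \<noteq> e" if m: "m \<in> supp (p * (q - ?q))" for m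
    proof -
      obtain a b where "m = a + b" "a \<in> supp p" "b \<in> supp (q - ?q)"
        using m keys_mult[of p "q - ?q"] by blast
      moreover from this(3) have "int (mdeg b) \<noteq> e - d"
        by (auto simp: in_keys_iff lookup_minus coef_hpart)
      ultimately show ?thesis
        using assms by (auto simp: homogeneous_def mdeg_add)
    qed
    then show ?thesis
      using supp_nonempty[of "hpart e (p * (q - ?q))"] unfolding supp_hpart by blast
  qed
  ultimately show ?thesis
    using hpart_add[of e "p * ?q" "p * (q - ?q)"] by (simp add: algebra_simps)
qed

lemma sum_hpart:
  assumes "finite D" "(\<lambda>m. int (mdeg m)) ` supp p \<subseteq> D"
  shows "(\<Sum>e\<in>D. hpart e p) = p"
proof (rule poly_mapping_eqI)
  fix m
  have "coef (\<Sum>e\<in>D. hpart e p) m = (\<Sum>e\<in>D. if int (mdeg m) = e then coef p m else 0)"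
    by (simp add: lookup_sum coef_hpart)
  also have "\<dots> = (if int (mdeg m) \<in> D then coef p m else 0)"
    using assms(1) by simp
  also have "\<dots> = coef p m"
    using assms(2) by (metis image_subset_iff in_keys_iff)
  finally show "coef (\<Sum>e\<in>D. hpart e p) m = coef p m" .
qed

section \<open>Submodules of free modules are finitely generated\<close>

text \<open>By induction on the set of variables. For the new variable \<open>x\<close>, the elements of \<open>L\<close> whose exponent at \<open>x\<close>
  exceeds those in a finite basis \<open>B0\<close> for the old variables are dominated by \<open>B0\<close>; each of the finitely
  many smaller exponents at \<open>x\<close> gives a slice of \<open>L\<close> that has a finite basis by induction.\<close>

lemma dickson:
  fixes e :: "'a \<Rightarrow> 'x \<Rightarrow> nat"
  assumes "finite X"
  shows "\<exists>B\<subseteq>L. finite B \<and> (\<forall>m\<in>L. \<exists>b\<in>B. \<forall>x\<in>X. e b x \<le> e m x)"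
  using assms
proof (induction X arbitrary: L rule: finite_induct)
  case empty
  show ?case
  proof (cases "L = {}")
    case False
    then obtain b where "b \<in> L" by blast
    then show ?thesis by (intro exI[of _ "{b}"]) auto
  qed auto
next
  case (insert x X)
  obtain B0 where B0: "B0 \<subseteq> L" "finite B0" "\<forall>m\<in>L. \<exists>b\<in>B0. \<forall>y\<in>X. e b y \<le> e m y"
    using insert.IH[of L] by blast
  define N where "N = Max (insert 0 ((\<lambda>b. e b x) ` B0))"
  have N: "e b x \<le> N" if "b \<in> B0" for b
    using B0(2) that by (auto simp: N_def intro!: Max_ge)
  define Q where "Q j B \<longleftrightarrow> B \<subseteq> {m \<in> L. e m x = j} \<and> finite B \<and>
      (\<forall>m\<in>{m \<in> L. e m x = j}. \<exists>b\<in>B. \<forall>y\<in>X. e b y \<le> e m y)" for j B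
  have "\<exists>B. Q j B" for j
    using insert.IH[of "{m \<in> L. e m x = j}"] by (simp only: Q_def)
  then obtain B where Q: "\<And>j. Q j (B j)"
    by metis
  have B: "B j \<subseteq> {m \<in> L. e m x = j}" "finite (B j)"
    "m \<in> L \<Longrightarrow> e m x = j \<Longrightarrow> \<exists>b\<in>B j. \<forall>y\<in>X. e b y \<le> e m y" for j m
    using Q[of j] by (simp_all add: Q_def)
  show ?case
  proof (intro exI[of _ "B0 \<union> (\<Union>j<N. B j)"] conjI ballI)
    show "B0 \<union> (\<Union>j<N. B j) \<subseteq> L"
      using B0(1) B(1) by blast
    show "finite (B0 \<union> (\<Union>j<N. B j))"
      using B0(2) B(2) by simp
    fix m assume m: "m \<in> L"
    show "\<exists>b\<in>B0 \<union> (\<Union>j<N. B j). \<forall>y\<in>insert x X. e b y \<le> e m y"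
    proof (cases "e m x < N")
      case True
      obtain b where "b \<in> B (e m x)" "\<forall>y\<in>X. e b y \<le> e m y"
        using B(3)[OF m refl] by blast
      moreover from this B(1) have "e b x = e m x" by blast
      ultimately show ?thesis using True by (intro bexI[of _ b]) auto
    next
      case False
      obtain b where "b \<in> B0" "\<forall>y\<in>X. e b y \<le> e m y"
        using B0(3) m by blast
      with False N[of b] show ?thesis by (intro bexI[of _ b]) auto
    qed
  qed
qed

text \<open>A monomial order without an order on the variables: give the variables in \<open>X\<close> distinct primes as
  weights and compare the products. Unique factorization makes the weight injective, products of
  monomials go to products, and the natural numbers are well-ordered.\<close>

lemma multiplicative_monomial_weight:
  assumes "finite X"
  obtains \<phi> :: "('x \<Rightarrow>\<^sub>0 nat) \<Rightarrow> nat" where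
    "\<And>m m'. \<phi> (m + m') = \<phi> m * \<phi> m'" "\<And>m. \<phi> m > 0" "inj_on \<phi> {m. Poly_Mapping.keys m \<subseteq> X}"
proof -
  obtain P :: "nat set" where P: "finite P" "card P = card X" "P \<subseteq> {p. prime p}"
    using infinite_arbitrarily_large[OF primes_infinite, of "card X"] by blast
  then obtain q where q: "bij_betw q X P"
    using finite_same_card_bij[OF assms P(1)] by metis
  have prime: "prime (q x)" if "x \<in> X" for x
    using that P(3) q by (auto simp: bij_betw_def)
  define \<phi> where "\<phi> m = (\<Prod>x\<in>X. q x ^ Poly_Mapping.lookup m x)" for m :: "'x \<Rightarrow>\<^sub>0 nat"
  have mult: "multiplicity (q x) (\<phi> m) = Poly_Mapping.lookup m x" if "x \<in> X" for x m
  proof -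
    have "\<phi> m = (\<Prod>p\<in>q ` X. p ^ Poly_Mapping.lookup m (the_inv_into X q p))"
      using q by (auto simp: \<phi>_def bij_betw_def prod.reindex the_inv_into_f_f)
    also have "multiplicity (q x) \<dots> = Poly_Mapping.lookup m x"
      using that q assms prime
      by (subst multiplicity_prod_prime_powers) (auto simp: bij_betw_def the_inv_into_f_f)
    finally show ?thesis .
  qed
  show ?thesis
  proof
    show "\<phi> (m + m') = \<phi> m * \<phi> m'" for m m'
      by (simp add: \<phi>_def lookup_add power_add prod.distrib)
    show "\<phi> m > 0" for m
      unfolding \<phi>_def using prime by (intro prod_pos) (auto intro: prime_gt_0_nat)
    show "inj_on \<phi> {m. Poly_Mapping.keys m \<subseteq> X}"
    proof (rule inj_onI, rule poly_mapping_eqI)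
      fix m m' x
      assume *: "m \<in> {m. Poly_Mapping.keys m \<subseteq> X}" "m' \<in> {m. Poly_Mapping.keys m \<subseteq> X}" "\<phi> m = \<phi> m'"
      show "Poly_Mapping.lookup m x = Poly_Mapping.lookup m' x"
      proof (cases "x \<in> X")
        case True
        with mult[of x m] mult[of x m'] * show ?thesis by simp
      next
        case False
        with * have "x \<notin> Poly_Mapping.keys m" "x \<notin> Poly_Mapping.keys m'" by auto
        then show ?thesis by (simp add: in_keys_iff)
      qed
    qed
  qed
qed

lemma supp_monomial_mult:
  assumes "m \<in> supp (Poly_Mapping.single c a * p)"
  obtains m' where "m = c + m'" "m' \<in> supp p"
  using keys_mult[of "Poly_Mapping.single c a" p] assms by (auto split: if_splits)

lemma coef_monomial_mult: "coef (Poly_Mapping.single c a * p) (c + m) = a * coef p m"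
proof -
  define p' where "p' = p - Poly_Mapping.single m (coef p m)"
  have "m \<notin> supp p'"
    by (simp add: p'_def in_keys_iff lookup_minus)
  then have "c + m \<notin> supp (Poly_Mapping.single c a * p')"
    by (auto elim!: supp_monomial_mult)
  moreover have "Poly_Mapping.single c a * p
      = Poly_Mapping.single (c + m) (a * coef p m) + Poly_Mapping.single c a * p'"
    by (simp add: p'_def algebra_simps mult_single)
  ultimately show ?thesis
    by (simp add: lookup_add in_keys_iff)
qed

text \<open>Elements of a free module are coordinate vectors indexed by the natural numbers, which vanish
  from the rank on, as for \<open>free_mod\<close>.\<close>

definition submodule :: "'x set \<Rightarrow> nat \<Rightarrow> (nat \<Rightarrow> ('x, 'k::field) mpoly) set \<Rightarrow> bool"
  where "submodule X r N \<longleftrightarrow> N \<subseteq> free_mod X r \<and> (\<lambda>_. 0) \<in> N \<and>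
    (\<forall>f\<in>N. \<forall>g\<in>N. (\<lambda>k. f k + g k) \<in> N) \<and> (\<forall>c\<in>poly_ring X. \<forall>f\<in>N. (\<lambda>k. c * f k) \<in> N)"

definition combs :: "'x set \<Rightarrow> (nat \<Rightarrow> ('x, 'k::field) mpoly) set \<Rightarrow> (nat \<Rightarrow> ('x, 'k) mpoly) set"
  where "combs X G = {(\<lambda>k. \<Sum>g\<in>G. c g * g k) | c. \<forall>g\<in>G. c g \<in> poly_ring X}"

lemma submodule_zero: "submodule X r N \<Longrightarrow> (\<lambda>_. 0) \<in> N"
  and submodule_add: "submodule X r N \<Longrightarrow> f \<in> N \<Longrightarrow> g \<in> N \<Longrightarrow> (\<lambda>k. f k + g k) \<in> N"
  and submodule_mult: "submodule X r N \<Longrightarrow> c \<in> poly_ring X \<Longrightarrow> f \<in> N \<Longrightarrow> (\<lambda>k. c * f k) \<in> N"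
  by (auto simp: submodule_def)

lemma submodule_sum:
  assumes "submodule X r N" "\<And>g. g \<in> A \<Longrightarrow> F g \<in> N"
  shows "(\<lambda>k. \<Sum>g\<in>A. F g k) \<in> N"
  using assms(2)
proof (induction A rule: infinite_finite_induct)
  case (insert x A)
  then show ?case using submodule_add[OF assms(1), of "F x" "\<lambda>k. \<Sum>g\<in>A. F g k"] by simp
qed (auto simp: submodule_zero[OF assms(1)])

lemma submodule_combs:
  assumes "submodule X r N" "G \<subseteq> N" shows "combs X G \<subseteq> N"
proof
  fix f assume "f \<in> combs X G"
  then obtain c where f: "f = (\<lambda>k. \<Sum>g\<in>G. c g * g k)" "\<forall>g\<in>G. c g \<in> poly_ring X"
    by (auto simp: combs_def)
  show "f \<in> N"
    unfolding f(1) using f(2) assms(2)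
    by (intro submodule_sum[OF assms(1)] submodule_mult[OF assms(1)]) auto
qed

lemma combs_zero: "(\<lambda>_. 0) \<in> combs X G"
  unfolding combs_def by (rule CollectI, rule exI[of _ "\<lambda>_. 0"]) (simp add: poly_ring_zero)

lemma combs_add:
  assumes "f \<in> combs X G" "g \<in> combs X G" shows "(\<lambda>k. f k + g k) \<in> combs X G"
proof -
  obtain c d where "f = (\<lambda>k. \<Sum>g\<in>G. c g * g k)" "\<forall>g\<in>G. c g \<in> poly_ring X"
    "g = (\<lambda>k. \<Sum>g\<in>G. d g * g k)" "\<forall>g\<in>G. d g \<in> poly_ring X"
    using assms by (auto simp: combs_def)
  then show ?thesis
    unfolding combs_def
    by (intro CollectI exI[of _ "\<lambda>g. c g + d g"])
       (auto simp: poly_ring_add sum.distrib distrib_right)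
qed

lemma combs_mult:
  assumes "f \<in> combs X G" "a \<in> poly_ring X" shows "(\<lambda>k. a * f k) \<in> combs X G"
proof -
  obtain c where "f = (\<lambda>k. \<Sum>g\<in>G. c g * g k)" "\<forall>g\<in>G. c g \<in> poly_ring X"
    using assms by (auto simp: combs_def)
  then show ?thesis
    unfolding combs_def using assms(2)
    by (intro CollectI exI[of _ "\<lambda>g. a * c g"])
       (auto simp: poly_ring_mult sum_distrib_left mult.assoc)
qed

lemma combs_generator:
  assumes "g \<in> G" "finite G" shows "g \<in> combs X G"
  unfolding combs_def using assms
  by (intro CollectI exI[of _ "\<lambda>h. if h = g then 1 else 0"])
     (auto simp: poly_ring_one poly_ring_zero if_distrib[of "\<lambda>x. x * _"] cong: if_cong)

lemma combs_sum: "(\<And>i. i \<in> A \<Longrightarrow> F i \<in> combs X G) \<Longrightarrow> (\<lambda>k. \<Sum>i\<in>A. F i k) \<in> combs X G"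
proof (induction A rule: infinite_finite_induct)
  case (insert x A)
  then show ?case using combs_add[of "F x" X G "\<lambda>k. \<Sum>i\<in>A. F i k"] by simp
qed (auto simp: combs_zero)

lemma combs_trans: "G \<subseteq> combs X H \<Longrightarrow> combs X G \<subseteq> combs X H"
proof
  fix f assume *: "G \<subseteq> combs X H" "f \<in> combs X G"
  then obtain c where f: "f = (\<lambda>k. \<Sum>g\<in>G. c g * g k)" "\<forall>g\<in>G. c g \<in> poly_ring X"
    by (auto simp: combs_def)
  show "f \<in> combs X H"
    unfolding f(1) using *(1) f(2) by (intro combs_sum combs_mult) auto
qed

text \<open>Order the positions \<open>(k, m)\<close>, monomial \<open>m\<close> in coordinate \<open>k\<close>, by the weight of \<open>m\<close> and then by \<open>k\<close>. Dickson's
  lemma gives, in every coordinate, finitely many leading monomials of elements of \<open>N\<close> such that every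
  leading monomial is divisible by one of them. Elements of \<open>N\<close> with these leading positions generate \<open>N\<close>: subtracting a multiple of one of
  them lowers the leading position of any element of \<open>N\<close>, and the positions are well-ordered.\<close>

theorem hilbert_basis:
  fixes N :: "(nat \<Rightarrow> ('x, 'k::field) mpoly) set"
  assumes X: "finite X" and N: "submodule X r N"
  shows "\<exists>G. finite G \<and> G \<subseteq> N \<and> N = combs X G"
proof -
  obtain \<phi> :: "('x \<Rightarrow>\<^sub>0 nat) \<Rightarrow> nat" where \<phi>:
    "\<And>m m'. \<phi> (m + m') = \<phi> m * \<phi> m'" "\<And>m. \<phi> m > 0" "inj_on \<phi> {m. Poly_Mapping.keys m \<subseteq> X}"
    using multiplicative_monomial_weight[OF X] by metis
  \<comment> \<open>Since coordinates are below \<open>r\<close>, this orders the pairs \<open>(\<phi> m, k)\<close> lexicographically.\<close>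
  define w where "w k m = \<phi> m * r + k" for k m
  define leads where "leads f k m \<longleftrightarrow> k < r \<and> m \<in> supp (f k) \<and>
    (\<forall>k'<r. \<forall>m'\<in>supp (f k'). w k' m' \<le> w k m)" for f :: "nat \<Rightarrow> ('x, 'k) mpoly" and k m
  have suppX: "Poly_Mapping.keys m \<subseteq> X" if "f \<in> N" "k < r" "m \<in> supp (f k)" for f k m
    using that N by (auto simp: submodule_def free_mod_def poly_ring_def)
  have w_inj: "k = k' \<and> m = m'"
    if "w k m = w k' m'" "k < r" "k' < r" "Poly_Mapping.keys m \<subseteq> X" "Poly_Mapping.keys m' \<subseteq> X" for k k' m m'
  proof -
    have "k = k'" using arg_cong[OF that(1), of "\<lambda>z. z mod r"] that by (simp add: w_def)
    moreover have "\<phi> m = \<phi> m'" using arg_cong[OF that(1), of "\<lambda>z. z div r"] that by (simp add: w_def)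
    ultimately show ?thesis using \<phi>(3) that by (auto simp: inj_on_def)
  qed
  have w_mono: "w k (c + m) \<le> w k' (c + m')"
    if "w k m \<le> w k' m'" "k < r" "k' < r" for k k' c m m'
  proof (cases "\<phi> m = \<phi> m'")
    case False
    have "\<phi> m * r < Suc (\<phi> m') * r" using that by (simp add: w_def)
    then have "\<phi> m < \<phi> m'" using False by (simp only: mult_less_cancel2) linarith
    then have "Suc (\<phi> c * \<phi> m) \<le> \<phi> c * \<phi> m'" using \<phi>(2)[of c]
      by (intro Suc_leI mult_less_mono2)
    then have "Suc (\<phi> c * \<phi> m) * r \<le> \<phi> c * \<phi> m' * r" by (rule mult_le_mono1)
    then show ?thesis using that by (simp add: w_def \<phi>(1))
  qed (use that in \<open>simp add: w_def \<phi>(1)\<close>)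
  define L where "L k = {m. \<exists>f\<in>N. leads f k m}" for k
  have "\<exists>B\<subseteq>L k. finite B \<and> (\<forall>m\<in>L k. \<exists>b\<in>B. \<forall>x\<in>X. Poly_Mapping.lookup b x \<le> Poly_Mapping.lookup m x)" for k
    by (rule dickson[OF X])
  then obtain B where B: "\<And>k. B k \<subseteq> L k" "\<And>k. finite (B k)"
    "\<And>k m. m \<in> L k \<Longrightarrow> \<exists>b\<in>B k. \<forall>x\<in>X. Poly_Mapping.lookup b x \<le> Poly_Mapping.lookup m x"
    by metis
  have "\<forall>k. \<forall>b\<in>B k. \<exists>f\<in>N. leads f k b" using B(1) by (auto simp: L_def)
  then obtain h where h: "\<And>k b. b \<in> B k \<Longrightarrow> h k b \<in> N \<and> leads (h k b) k b" by metis
  define G where "G = (\<lambda>(k, b). h k b) ` (SIGMA k:{..<r}. B k)"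
  have G: "finite G" "G \<subseteq> N" using B(2) h by (auto simp: G_def)
  have "f \<in> combs X G" if "f \<in> N" "\<And>k m. k < r \<Longrightarrow> m \<in> supp (f k) \<Longrightarrow> w k m < n" for f n
    using that
  proof (induction n arbitrary: f)
    case 0
    have "f k = 0" for k
    proof (cases "k < r")
      case True
      then show ?thesis using 0(2)[of k] supp_nonempty[of "f k"] by blast
    next
      case False
      then show ?thesis using 0(1) N by (auto simp: submodule_def free_mod_def)
    qed
    then have "f = (\<lambda>_. 0)" by auto
    then show ?case by (simp add: combs_zero)
  next
    case (Suc n)
    show ?case
    proof (cases "\<exists>k<r. \<exists>m\<in>supp (f k). w k m = n")
      case False
      then show ?thesis using Suc.prems by (intro Suc.IH) (force simp: less_Suc_eq)+
    next
      case True
      then obtain k m where km: "k < r" "m \<in> supp (f k)" "w k m = n" by blast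
      have "leads f k m" unfolding leads_def using km Suc.prems(2) by (auto simp: less_Suc_eq_le)
      then have "m \<in> L k" using Suc.prems(1) by (auto simp: L_def)
      then obtain b where b: "b \<in> B k" "\<forall>x\<in>X. Poly_Mapping.lookup b x \<le> Poly_Mapping.lookup m x"
        using B(3) by blast
      define g where "g = h k b"
      have g: "g \<in> N" "leads g k b" "g \<in> G" using h[OF b(1)] b(1) km(1) by (auto simp: g_def G_def)
      have mX: "Poly_Mapping.keys m \<subseteq> X" using suppX Suc.prems(1) km by blast
      have bX: "Poly_Mapping.keys b \<subseteq> X" using g suppX km by (auto simp: leads_def)
      define c where "c = m - b"
      have m: "m = c + b"
      proof (rule poly_mapping_eqI)
        fix x
        have "Poly_Mapping.lookup b x \<le> Poly_Mapping.lookup m x"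
        proof (cases "x \<in> X")
          case False
          with bX have "x \<notin> Poly_Mapping.keys b" by auto
          then show ?thesis by (simp add: in_keys_iff)
        qed (use b in auto)
        then show "Poly_Mapping.lookup m x = Poly_Mapping.lookup (c + b) x"
          by (simp add: c_def lookup_add minus_poly_mapping.rep_eq)
      qed
      have cX: "Poly_Mapping.keys c \<subseteq> X"
        using mX by (auto simp: c_def in_keys_iff minus_poly_mapping.rep_eq)
      define a where "a = coef (f k) m / coef (g k) b"
      have gb: "coef (g k) b \<noteq> 0" using g(2) by (auto simp: leads_def in_keys_iff)
      define t where "t = (Poly_Mapping.single c (- a) :: ('x, 'k) mpoly)"
      have t: "t \<in> poly_ring X" "- t \<in> poly_ring X" using cX by (auto simp: t_def poly_ring_def)
      define f' where "f' = (\<lambda>k. f k + t * g k)"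
      have f': "f' \<in> N"
        unfolding f'_def using submodule_add[OF N Suc.prems(1) submodule_mult[OF N t(1) g(1)]] .
      have less: "w k' m' < n" if "k' < r" "m' \<in> supp (f' k')" for k' m'
      proof -
        have "w k' m' \<le> n"
        proof (cases "m' \<in> supp (f k')")
          case True
          then show ?thesis using Suc.prems(2)[OF \<open>k' < r\<close> True] by simp
        next
          case False
          with that(2) have "m' \<in> supp (t * g k')"
            using Poly_Mapping.keys_add[of "f k'" "t * g k'"] by (auto simp: f'_def)
          then obtain m'' where m'': "m' = c + m''" "m'' \<in> supp (g k')"
            unfolding t_def by (rule supp_monomial_mult)
          have "w k' m'' \<le> w k b" using g(2) m''(2) that(1) by (auto simp: leads_def)
          from w_mono[OF this that(1) km(1), of c] show ?thesis using m'' m km(3) by simp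
        qed
        moreover have "w k' m' \<noteq> n"
        proof
          assume "w k' m' = n"
          then have "k' = k \<and> m' = m"
            using w_inj[of k' m' k m] km that suppX[OF f' that] mX by simp
          moreover have "coef (f' k) m = 0"
            unfolding f'_def lookup_add t_def m coef_monomial_mult
            using gb by (simp add: a_def m)
          ultimately show False using that(2) by (simp add: in_keys_iff)
        qed
        ultimately show ?thesis by simp
      qed
      have "f' \<in> combs X G"
      proof (rule Suc.IH)
        show "f' \<in> N" by (rule f')
        show "w k' m' < n" if "k' < r" "m' \<in> supp (f' k')" for k' m'
          using that by (rule less)
      qed
      moreover have "f = (\<lambda>k. f' k + (- t) * g k)" by (auto simp: f'_def)
      ultimately show ?thesis
        using combs_add[of f' X G "\<lambda>k. (- t) * g k"] combs_mult[OF combs_generator[OF g(3) G(1)] t(2)]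
        by simp
    qed
  qed
  note claim = this
  have "N \<subseteq> combs X G"
  proof
    fix f assume f: "f \<in> N"
    define W where "W = (\<lambda>(k, m). w k m) ` (SIGMA k:{..<r}. supp (f k))"
    have "finite W" by (auto simp: W_def)
    have "w k m < Suc (Max W)" if "k < r" "m \<in> supp (f k)" for k m
    proof -
      have "w k m \<in> W" using that by (force simp: W_def)
      then show ?thesis using Max_ge[OF \<open>finite W\<close>] by (simp add: less_Suc_eq_le)
    qed
    then show "f \<in> combs X G" by (rule claim[OF f])
  qed
  then have "N = combs X G" using submodule_combs[OF N G(2)] by (rule subset_antisym)
  then show ?thesis using G by blast
qed

section \<open>Existence of minimal graded free resolutions\<close>

text \<open>The \<open>k\<close>-th basis vector has degree \<open>s k\<close>, so the component of degree \<open>d\<close> of a vector has the part of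
  degree \<open>d - s k\<close> of its \<open>k\<close>-th coordinate.\<close>

definition graded_submodule ::
    "'x set \<Rightarrow> nat \<Rightarrow> (nat \<Rightarrow> int) \<Rightarrow> (nat \<Rightarrow> ('x, 'k::field) mpoly) set \<Rightarrow> bool"
  where "graded_submodule X r s N \<longleftrightarrow>
    submodule X r N \<and> (\<forall>f\<in>N. \<forall>d. (\<lambda>k. hpart (d - s k) (f k)) \<in> N)"

text \<open>The homogeneous components of finitely many generators again lie in \<open>N\<close>, are finite in number, and
  add up to the generators.\<close>

lemma homogeneous_generators:
  fixes N :: "(nat \<Rightarrow> ('x, 'k::field) mpoly) set"
  assumes "finite X" "graded_submodule X r s N"
  shows "\<exists>G. finite G \<and> G \<subseteq> N \<and> N = combs X G \<and> (\<forall>g\<in>G. \<exists>d. \<forall>k. homogeneous (d - s k) (g k))"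
proof -
  have N: "submodule X r N" and hp: "\<And>f d. f \<in> N \<Longrightarrow> (\<lambda>k. hpart (d - s k) (f k)) \<in> N"
    using assms(2) by (auto simp: graded_submodule_def)
  obtain G where G: "finite G" "G \<subseteq> N" "N = combs X G"
    using hilbert_basis[OF assms(1) N] by blast
  define D where "D g = (\<Union>k<r. (\<lambda>m. int (mdeg m) + s k) ` supp (g k))" for g :: "nat \<Rightarrow> ('x, 'k) mpoly"
  define H where "H = (\<lambda>(g, d). (\<lambda>k. hpart (d - s k) (g k))) ` (SIGMA g:G. D g)"
  have H: "finite H" "H \<subseteq> N"
    using G hp by (auto simp: H_def D_def)
  have "g \<in> combs X H" if g: "g \<in> G" for g
  proof -
    have "g k = (\<Sum>d\<in>D g. hpart (d - s k) (g k))" for k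
    proof (cases "k < r")
      case True
      have "(\<Sum>d\<in>D g. hpart (d - s k) (g k)) = (\<Sum>e\<in>(\<lambda>d. d - s k) ` D g. hpart e (g k))"
        by (simp add: sum.reindex inj_on_def)
      also have "\<dots> = g k"
      proof (rule sum_hpart)
        show "finite ((\<lambda>d. d - s k) ` D g)" by (simp add: D_def)
        show "(\<lambda>m. int (mdeg m)) ` supp (g k) \<subseteq> (\<lambda>d. d - s k) ` D g"
        proof
          fix e assume "e \<in> (\<lambda>m. int (mdeg m)) ` supp (g k)"
          then have "e + s k \<in> D g" using True by (auto simp: D_def)
          then show "e \<in> (\<lambda>d. d - s k) ` D g" by (rule rev_image_eqI) simp
        qed
      qed
      finally show ?thesis by simp
    next
      case False
      then have "g k = 0" using g G(2) N by (auto simp: submodule_def free_mod_def)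
      then show ?thesis by simp
    qed
    then have "g = (\<lambda>k. \<Sum>d\<in>D g. hpart (d - s k) (g k))" by auto
    also have "\<dots> \<in> combs X H"
    proof (rule combs_sum)
      fix d assume "d \<in> D g"
      then show "(\<lambda>k. hpart (d - s k) (g k)) \<in> combs X H"
        using g H(1) by (intro combs_generator) (auto simp: H_def)
    qed
    finally show ?thesis .
  qed
  then have "N \<subseteq> combs X H"
    unfolding G(3) by (intro combs_trans) auto
  then have "N = combs X H"
    using submodule_combs[OF N H(2)] by (rule subset_antisym)
  moreover have "\<forall>h\<in>H. \<exists>d. \<forall>k. homogeneous (d - s k) (h k)"
    using homogeneous_hpart by (fastforce simp: H_def)
  ultimately show ?thesis using H by blast
qed

lemma hpart_zero_degree: "hpart 0 p = cst (coef p 0)"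
  using homogeneous_nonpos[OF homogeneous_hpart[of 0 p]] by (simp add: coef_hpart)

text \<open>Take a set of homogeneous generators of least cardinality. If the coefficient of \<open>g0\<close> in a relation
  had a constant term, then in the part of the relation in the degree of \<open>g0\<close> that coefficient would be a
  nonzero scalar. So \<open>g0\<close> would be a combination of the other generators and could be dropped.\<close>

lemma minimal_homogeneous_generators:
  fixes N :: "(nat \<Rightarrow> ('x, 'k::field) mpoly) set"
  assumes X: "finite X" and N: "graded_submodule X r s N"
  shows "\<exists>G \<delta>. finite G \<and> G \<subseteq> N \<and> N = combs X G \<and>
    (\<forall>g\<in>G. \<forall>k. homogeneous (\<delta> g - s k) (g k)) \<and>
    (\<forall>c. (\<forall>g\<in>G. c g \<in> poly_ring X) \<and> (\<forall>k. (\<Sum>g\<in>G. c g * g k) = 0)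
      \<longrightarrow> (\<forall>g\<in>G. coef (c g) 0 = 0))"
proof -
  define P where "P G \<longleftrightarrow> finite G \<and> G \<subseteq> N \<and> N = combs X G \<and>
    (\<forall>g\<in>G. \<exists>d. \<forall>k. homogeneous (d - s k) (g k))" for G
  obtain G0 where "P G0"
    using homogeneous_generators[OF X N] by (auto simp: P_def)
  then obtain G where PG: "P G" and least: "\<And>H. P H \<Longrightarrow> card G \<le> card H"
    using ex_has_least_nat[of P G0 card] by blast
  have G: "finite G" "G \<subseteq> N" "N = combs X G" "\<forall>g\<in>G. \<exists>d. \<forall>k. homogeneous (d - s k) (g k)"
    using PG by (auto simp: P_def)
  then obtain \<delta> where \<delta>: "\<And>g k. g \<in> G \<Longrightarrow> homogeneous (\<delta> g - s k) (g k)"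
    by metis
  show ?thesis
  proof (intro exI[of _ G] exI[of _ \<delta>] conjI allI impI ballI)
    fix c g0
    assume "(\<forall>g\<in>G. c g \<in> poly_ring X) \<and> (\<forall>k. (\<Sum>g\<in>G. c g * g k) = 0)" and g0: "g0 \<in> G"
    then have c: "\<forall>g\<in>G. c g \<in> poly_ring X" "\<forall>k. (\<Sum>g\<in>G. c g * g k) = 0" by auto
    show "coef (c g0) 0 = 0"
    proof (rule ccontr)
      define a where "a = coef (c g0) 0"
      assume "coef (c g0) 0 \<noteq> 0"
      then have a: "a \<noteq> 0" by (simp add: a_def)
      define c' where "c' g = hpart (\<delta> g0 - \<delta> g) (c g)" for g
      define H where "H = G - {g0}"
      have "g0 k = (\<Sum>g\<in>H. (cst (- inverse a) * c' g) * g k)" for k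
      proof -
        have "0 = hpart (\<delta> g0 - s k) (\<Sum>g\<in>G. c g * g k)"
          using c(2) by simp
        also have "\<dots> = (\<Sum>g\<in>G. hpart (\<delta> g0 - s k) (g k * c g))"
          by (simp add: hpart_sum mult.commute)
        also have "\<dots> = (\<Sum>g\<in>G. c' g * g k)"
        proof (rule sum.cong)
          fix g assume "g \<in> G"
          from hpart_mult[OF \<delta>[OF this], of "\<delta> g0 - s k" k "c g"]
          show "hpart (\<delta> g0 - s k) (g k * c g) = c' g * g k"
            by (simp add: c'_def mult.commute)
        qed simp
        also have "\<dots> = cst a * g0 k + (\<Sum>g\<in>H. c' g * g k)"
          using G(1) g0 by (simp add: H_def sum.remove c'_def hpart_zero_degree a_def)
        finally have "cst a * g0 k = - (\<Sum>g\<in>H. c' g * g k)"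
          by (simp add: eq_neg_iff_add_eq_0)
        then have "cst (inverse a) * (cst a * g0 k) = cst (inverse a) * - (\<Sum>g\<in>H. c' g * g k)"
          by simp
        then show ?thesis
          using a by (simp add: mult.assoc[symmetric] mult_single sum_distrib_left single_uminus sum_negf)
      qed
      then have "g0 = (\<lambda>k. \<Sum>g\<in>H. (cst (- inverse a) * c' g) * g k)" by auto
      moreover have "\<forall>g\<in>H. cst (- inverse a) * c' g \<in> poly_ring X"
        using c(1) by (auto simp: H_def c'_def intro!: poly_ring_mult cst_in_poly_ring hpart_in_poly_ring)
      ultimately have "g0 \<in> combs X H"
        unfolding combs_def by (intro CollectI exI[of _ "\<lambda>g. cst (- inverse a) * c' g"] conjI)
      moreover have "H \<subseteq> combs X H"
        using G(1) combs_generator[of _ H X] by (auto simp: H_def)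
      ultimately have "G \<subseteq> combs X H"
        by (auto simp: H_def)
      then have "N \<subseteq> combs X H"
        unfolding G(3) by (rule combs_trans)
      moreover have "combs X H \<subseteq> N"
        using N G(2) by (intro submodule_combs[of X r]) (auto simp: graded_submodule_def H_def)
      ultimately have "P H"
        using G by (auto simp: P_def H_def)
      from least[OF this] show False
        using card_Diff1_less[OF G(1) g0] by (simp add: H_def)
    qed
  qed (use G \<delta> in auto)
qed

definition lin_map ::
    "nat \<Rightarrow> nat \<Rightarrow> (nat \<Rightarrow> nat \<Rightarrow> ('x, 'k::field) mpoly) \<Rightarrow> (nat \<Rightarrow> ('x, 'k) mpoly) \<Rightarrow> nat \<Rightarrow> ('x, 'k) mpoly"
  where "lin_map r R A f = (\<lambda>k. if k < r then (\<Sum>l<R. A k l * f l) else 0)"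

definition graded_matrix ::
    "'x set \<Rightarrow> nat \<Rightarrow> (nat \<Rightarrow> int) \<Rightarrow> nat \<Rightarrow> (nat \<Rightarrow> int) \<Rightarrow> (nat \<Rightarrow> nat \<Rightarrow> ('x, 'k::field) mpoly) \<Rightarrow> bool"
  where "graded_matrix X r s R s' A \<longleftrightarrow>
    (\<forall>k<r. \<forall>l<R. A k l \<in> poly_ring X \<and> homogeneous (s' l - s k) (A k l))"

text \<open>The columns of the matrix are the generators of \<open>minimal_homogeneous_generators\<close>, whose relations have
  coefficients without constant term.\<close>

lemma minimal_cover:
  fixes N :: "(nat \<Rightarrow> ('x, 'k::field) mpoly) set"
  assumes X: "finite X" and N: "graded_submodule X r s N"
  shows "\<exists>R s' A. graded_matrix X r s R s' A \<and> N = lin_map r R A ` free_mod X R \<and>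
    (\<forall>f\<in>free_mod X R. lin_map r R A f = (\<lambda>_. 0) \<longrightarrow> (\<forall>l. coef (f l) 0 = 0))"
proof -
  obtain G \<delta> where G: "finite G" "G \<subseteq> N" "N = combs X G"
    "\<forall>g\<in>G. \<forall>k. homogeneous (\<delta> g - s k) (g k)"
    "\<forall>c. (\<forall>g\<in>G. c g \<in> poly_ring X) \<and> (\<forall>k. (\<Sum>g\<in>G. c g * g k) = 0)
      \<longrightarrow> (\<forall>g\<in>G. coef (c g) 0 = 0)"
    using minimal_homogeneous_generators[OF X N] by (elim exE conjE)
  define R where "R = card G"
  obtain e where e: "bij_betw e {..<R} G"
    using ex_bij_betw_nat_finite[OF G(1)] by (auto simp: R_def atLeast0LessThan)
  define e' where "e' = the_inv_into {..<R} e"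
  have e_e': "e (e' g) = g" "e' g < R" if "g \<in> G" for g
    using e that the_inv_into_into[of e "{..<R}" g "{..<R}"] unfolding e'_def bij_betw_def
    by (simp_all add: f_the_inv_into_f)
  have e'_e: "\<And>l. l < R \<Longrightarrow> e' (e l) = l" and eG: "\<And>l. l < R \<Longrightarrow> e l \<in> G"
    using e unfolding e'_def bij_betw_def by (auto simp: the_inv_into_f_f)
  have Gfree: "\<And>g. g \<in> G \<Longrightarrow> g \<in> free_mod X r"
    using G(2) N by (auto simp: graded_submodule_def submodule_def)
  define A where "A k l = e l k" for k l
  have lin: "lin_map r R A f = (\<lambda>k. \<Sum>g\<in>G. f (e' g) * g k)" for f
  proof
    fix k
    show "lin_map r R A f k = (\<Sum>g\<in>G. f (e' g) * g k)"
    proof (cases "k < r")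
      case True
      have "(\<Sum>g\<in>G. f (e' g) * g k) = (\<Sum>l<R. f (e' (e l)) * e l k)"
        by (rule sum.reindex_bij_betw[OF e, symmetric])
      then show ?thesis using True by (simp add: lin_map_def A_def e'_e mult.commute)
    next
      case False
      then have "\<forall>g\<in>G. f (e' g) * g k = 0"
        using Gfree by (force simp: free_mod_def)
      then have "(\<Sum>g\<in>G. f (e' g) * g k) = 0" by (simp add: sum.neutral)
      then show ?thesis using False by (simp add: lin_map_def)
    qed
  qed
  show ?thesis
  proof (intro exI[of _ R] exI[of _ "\<delta> \<circ> e"] exI[of _ A] conjI ballI impI allI)
    show "graded_matrix X r s R (\<delta> \<circ> e) A"
      using G(4) eG Gfree[OF eG] by (auto simp: graded_matrix_def A_def free_mod_def)
    show "N = lin_map r R A ` free_mod X R"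
    proof
      show "lin_map r R A ` free_mod X R \<subseteq> N"
      proof
        fix h assume "h \<in> lin_map r R A ` free_mod X R"
        then obtain f where "f \<in> free_mod X R" "h = (\<lambda>k. \<Sum>g\<in>G. f (e' g) * g k)"
          unfolding lin by blast
        then show "h \<in> N"
          unfolding G(3) combs_def using e_e'(2)
          by (intro CollectI exI[of _ "\<lambda>g. f (e' g)"]) (simp add: free_mod_def)
      qed
      show "N \<subseteq> lin_map r R A ` free_mod X R"
      proof
        fix f assume "f \<in> N"
        then obtain c where c: "f = (\<lambda>k. \<Sum>g\<in>G. c g * g k)" "\<forall>g\<in>G. c g \<in> poly_ring X"
          unfolding G(3) combs_def by blast
        define f' where "f' l = (if l < R then c (e l) else 0)" for l
        have "f' \<in> free_mod X R" using c(2) eG by (auto simp: free_mod_def f'_def)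
        moreover have "lin_map r R A f' = f" unfolding lin c(1) by (auto simp: f'_def e_e')
        ultimately show "f \<in> lin_map r R A ` free_mod X R" by blast
      qed
    qed
    fix f l assume f: "f \<in> free_mod X R" "lin_map r R A f = (\<lambda>_. 0)"
    show "coef (f l) 0 = 0"
    proof (cases "l < R")
      case True
      have "\<forall>k. (\<Sum>g\<in>G. f (e' g) * g k) = 0"
        using fun_cong[OF f(2)] unfolding lin by simp
      moreover have "\<forall>g\<in>G. f (e' g) \<in> poly_ring X"
        using f(1) e_e' by (auto simp: free_mod_def)
      ultimately have "coef (f (e' (e l))) 0 = 0"
        using G(5)[rule_format, of "\<lambda>g. f (e' g)" "e l"] eG[OF True] by simp
      then show ?thesis using e'_e[OF True] by simp
    next
      case False
      then show ?thesis using f(1) by (simp add: free_mod_def)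
    qed
  qed
qed

lemma hpart_matrix_row:
  assumes "graded_matrix X r s R s' A" "k < r"
  shows "hpart (d - s k) (\<Sum>l<R. A k l * f l) = (\<Sum>l<R. A k l * hpart (d - s' l) (f l))"
  unfolding hpart_sum
proof (rule sum.cong)
  fix l assume "l \<in> {..<R}"
  then have "homogeneous (s' l - s k) (A k l)"
    using assms by (auto simp: graded_matrix_def)
  from hpart_mult[OF this] show "hpart (d - s k) (A k l * f l) = A k l * hpart (d - s' l) (f l)"
    by simp
qed simp

text \<open>The map preserves degrees, so it commutes with taking homogeneous components.\<close>

lemma graded_submodule_kernel:
  assumes "graded_matrix X r s R s' A"
  shows "graded_submodule X R s' {f \<in> free_mod X R. lin_map r R A f = (\<lambda>_. 0)}"
proof -
  have eq: "lin_map r R A f = (\<lambda>_. 0) \<longleftrightarrow> (\<forall>k<r. (\<Sum>l<R. A k l * f l) = 0)" for f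
    by (auto simp: lin_map_def fun_eq_iff)
  have 1: "(\<Sum>l<R. A k l * (c * f l)) = c * (\<Sum>l<R. A k l * f l)" for k c f
    by (simp add: sum_distrib_left mult.left_commute)
  have 2: "\<forall>k<r. (\<Sum>l<R. A k l * hpart (d - s' l) (f l)) = 0" if "\<forall>k<r. (\<Sum>l<R. A k l * f l) = 0" for d f
  proof (intro allI impI)
    fix k assume k: "k < r"
    have "(\<Sum>l<R. A k l * hpart (d - s' l) (f l)) = hpart (d - s k) (\<Sum>l<R. A k l * f l)"
      by (rule hpart_matrix_row[OF assms k, symmetric])
    then show "(\<Sum>l<R. A k l * hpart (d - s' l) (f l)) = 0" using that k by simp
  qed
  show ?thesis
    unfolding graded_submodule_def submodule_def eq using 2
    by (auto simp: free_mod_def poly_ring_add poly_ring_mult poly_ring_zero hpart_in_poly_ring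
        distrib_left sum.distrib 1)
qed

definition homogeneous_ideal :: "'x set \<Rightarrow> ('x, 'k::field) mpoly set \<Rightarrow> bool"
  where "homogeneous_ideal X J \<longleftrightarrow> J \<subseteq> poly_ring X \<and> 0 \<in> J \<and> (\<forall>p\<in>J. \<forall>q\<in>J. p + q \<in> J) \<and>
    (\<forall>c\<in>poly_ring X. \<forall>p\<in>J. c * p \<in> J) \<and> (\<forall>p\<in>J. \<forall>e. hpart e p \<in> J)"

text \<open>Iterate \<open>minimal_cover\<close>. A state \<open>(r, s, N, A)\<close> of the construction records the rank and the shifts of the
  last free module, the graded submodule \<open>N\<close> of it that remains to be covered, and the matrix \<open>A\<close> that
  leads from it to the previous free module. The first \<open>N\<close> is \<open>J\<close>, every later one is the kernel of \<open>A\<close>. That each \<open>N\<close>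
  consists of vectors over the irrelevant ideal is the minimality of the resolution.\<close>

theorem minimal_resolution_exists:
  fixes J :: "('x, 'k::field) mpoly set"
  assumes X: "finite X" and J: "homogeneous_ideal X J" "J \<subseteq> irrelevant_ideal X"
  shows "\<exists>F. minimal_graded_free_resolution X J F"
proof -
  define N0 where "N0 = {f \<in> free_mod X 1. f 0 \<in> J}"
  define P where "P = (\<lambda>(n::nat) (r, s, N::(nat \<Rightarrow> ('x, 'k) mpoly) set, A::nat \<Rightarrow> nat \<Rightarrow> ('x, 'k) mpoly).
    graded_submodule X r s N \<and> (\<forall>f\<in>N. \<forall>k. coef (f k) 0 = 0) \<and>
    (n = 0 \<longrightarrow> r = 1 \<and> s = (\<lambda>_. 0) \<and> N = N0))"
  define Q where "Q = (\<lambda>(n::nat) (r, s, N::(nat \<Rightarrow> ('x, 'k) mpoly) set, A::nat \<Rightarrow> nat \<Rightarrow> ('x, 'k) mpoly) (r', s', N', A').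
    graded_matrix X r s r' s' A' \<and> N = lin_map r r' A' ` free_mod X r' \<and>
    N' = {f \<in> free_mod X r'. lin_map r r' A' f = (\<lambda>_. 0)})"
  have "\<exists>st. \<forall>n. P n (st n) \<and> Q n (st n) (st (Suc n))"
  proof (rule dependent_nat_choice)
    have "graded_submodule X 1 (\<lambda>_. 0) N0"
      using J(1) by (auto simp: graded_submodule_def submodule_def N0_def homogeneous_ideal_def
          free_mod_def poly_ring_zero poly_ring_add poly_ring_mult hpart_in_poly_ring)
    moreover have "coef (f k) 0 = 0" if "f \<in> N0" for f k
      using that J(2) by (cases k) (auto simp: N0_def free_mod_def irrelevant_ideal_def)
    \<comment> \<open>No matrix leads out of \<open>F\<^sub>0\<close>; the last component is a placeholder.\<close>
    ultimately show "\<exists>x. P 0 x"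
      by (intro exI[of _ "(1, \<lambda>_. 0, N0, \<lambda>_ _. 0)"]) (auto simp: P_def)
  next
    fix x n assume "P n x"
    obtain r s N A where x: "x = (r, s, N, A)" by (cases x) auto
    have N: "graded_submodule X r s N" using \<open>P n x\<close> by (simp add: P_def x)
    obtain R s' A' where *: "graded_matrix X r s R s' A'" "N = lin_map r R A' ` free_mod X R"
      "\<forall>f\<in>free_mod X R. lin_map r R A' f = (\<lambda>_. 0) \<longrightarrow> (\<forall>l. coef (f l) 0 = 0)"
      using minimal_cover[OF X N] by (elim exE conjE)
    define K where "K = {f \<in> free_mod X R. lin_map r R A' f = (\<lambda>_. 0)}"
    have "P (Suc n) (R, s', K, A')"
      using *(3) graded_submodule_kernel[OF *(1)] by (simp add: P_def K_def)
    moreover have "Q n x (R, s', K, A')"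
      using *(1,2) by (simp add: Q_def x K_def)
    ultimately show "\<exists>y. P (Suc n) y \<and> Q n x y" by blast
  qed
  then obtain st where st: "\<And>n. P n (st n)" "\<And>n. Q n (st n) (st (Suc n))" by blast
  define r where "r n = fst (st n)" for n
  define s where "s n = fst (snd (st n))" for n
  define N where "N n = fst (snd (snd (st n)))" for n
  define A where "A n = snd (snd (snd (st n)))" for n
  have st_eq: "st n = (r n, s n, N n, A n)" for n
    by (simp add: r_def s_def N_def A_def)
  have zero: "r 0 = 1" "s 0 = (\<lambda>_. 0)" "N 0 = N0"
    using st(1)[of 0] by (auto simp: P_def st_eq)
  have irr: "coef (f k) 0 = 0" if "f \<in> N n" for f k n
    using st(1)[of n] that by (auto simp: P_def st_eq)
  have sub: "f k \<in> poly_ring X" if "f \<in> N n" for f k n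
    using st(1)[of n] that
    by (cases "k < r n") (auto simp: P_def st_eq graded_submodule_def submodule_def free_mod_def poly_ring_zero)
  have mat: "graded_matrix X (r n) (s n) (r (Suc n)) (s (Suc n)) (A (Suc n))"
    and im: "N n = lin_map (r n) (r (Suc n)) (A (Suc n)) ` free_mod X (r (Suc n))"
    and ker: "N (Suc n) = {f \<in> free_mod X (r (Suc n)). lin_map (r n) (r (Suc n)) (A (Suc n)) f = (\<lambda>_. 0)}" for n
    using st(2)[of n] by (auto simp: Q_def st_eq)
  define F :: "('x, 'k) free_complex" where "F = \<lparr>rk = r, shift = s, aug = (\<lambda>_. 1), diff = A\<rparr>"
  have rk: "rk F = r"
    by (simp add: F_def)
  have diff: "diff_map F (Suc n) = lin_map (r n) (r (Suc n)) (A (Suc n))" for n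
    by (auto simp: fun_eq_iff diff_map_def lin_map_def F_def)
  have aug: "aug_map F f = f 0" for f
    by (simp add: aug_map_def F_def zero)
  have gr: "graded_free_complex X F"
    unfolding graded_free_complex_def
  proof (intro conjI allI impI)
    show "aug F k \<in> poly_ring X" "homogeneous (shift F 0 k) (aug F k)" for k
      using homogeneous_cst[of 1] by (auto simp: F_def poly_ring_one zero)
    fix i k l :: nat assume *: "1 \<le> i" "k < rk F (i - 1)" "l < rk F i"
    then obtain n where i: "i = Suc n" by (cases i) auto
    show "diff F i k l \<in> poly_ring X" "homogeneous (shift F i l - shift F (i - 1) k) (diff F i k l)"
      using mat[of n] * by (auto simp: i F_def graded_matrix_def)
  qed
  have ex_S: "\<exists>f\<in>chain_mod X F 0. p - aug_map F f \<in> J" if "p \<in> poly_ring X" for p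
  proof
    show "p - aug_map F (\<lambda>k. if k = 0 then p else 0) \<in> J"
      using J(1) by (simp add: aug homogeneous_ideal_def)
    show "(\<lambda>k. if k = 0 then p else 0) \<in> chain_mod X F 0"
      using that by (simp add: rk zero free_mod_def)
  qed
  have ex_0: "{f \<in> chain_mod X F 0. aug_map F f \<in> J} = diff_map F 1 ` chain_mod X F 1"
    using im[of 0] diff[of 0] by (simp add: aug zero N0_def rk)
  have ex_i: "{f \<in> chain_mod X F i. diff_map F i f = (\<lambda>_. 0)} = diff_map F (i + 1) ` chain_mod X F (i + 1)"
    if "1 \<le> i" for i
  proof -
    obtain n where i: "i = Suc n" using \<open>1 \<le> i\<close> by (cases i) auto
    have "{f \<in> chain_mod X F i. diff_map F i f = (\<lambda>_. 0)} = N (Suc n)"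
      by (simp only: ker i rk diff)
    also have "\<dots> = diff_map F (i + 1) ` chain_mod X F (i + 1)"
      using im[of "Suc n"] by (simp only: i rk diff Suc_eq_plus1[symmetric])
    finally show ?thesis .
  qed
  have minimal: "diff_map F i f k \<in> irrelevant_ideal X" if "1 \<le> i" "f \<in> chain_mod X F i" for i f k
  proof -
    obtain n where i: "i = Suc n" using \<open>1 \<le> i\<close> by (cases i) auto
    have "diff_map F i f \<in> N n" using that(2) by (simp only: im i diff rk imageI)
    then show ?thesis using irr sub by (auto simp: irrelevant_ideal_def)
  qed
  have "minimal_graded_free_resolution X J F"
    unfolding minimal_graded_free_resolution_def graded_free_resolution_def
    by (intro conjI allI impI ballI gr ex_S ex_0 ex_i minimal)
  then show ?thesis ..
qed

section \<open>Finite linear algebra over the coefficient field\<close>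

definition lin_indep :: "'e set \<Rightarrow> ('e \<Rightarrow> ('x, 'k::field) mpoly) \<Rightarrow> bool"
  where "lin_indep E f \<longleftrightarrow> (\<forall>c. (\<Sum>e\<in>E. cst (c e) * f e) = 0 \<longrightarrow> (\<forall>e\<in>E. c e = 0))"

definition lin_span :: "'e set \<Rightarrow> ('e \<Rightarrow> ('x, 'k::field) mpoly) \<Rightarrow> ('x, 'k) mpoly set"
  where "lin_span E f = {(\<Sum>e\<in>E. cst (c e) * f e) | c. True}"

lemma vector_space_cst: "vector_space (\<lambda>a (p :: ('x, 'k::field) mpoly). cst a * p)"
  by unfold_locales (simp_all add: distrib_left distrib_right single_add mult_single flip: mult.assoc)

text \<open>Steinitz' exchange lemma for indexed families. The family \<open>g\<close> is injective on \<open>D\<close> because it is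
  linearly independent, so it can be treated as a set in the vector space of all polynomials.\<close>

lemma lin_indep_card_le:
  fixes f :: "'e \<Rightarrow> ('x, 'k::field) mpoly" and g :: "'d \<Rightarrow> ('x, 'k) mpoly"
  assumes fin: "finite D" "finite E" and indep: "lin_indep D g" and span: "\<And>d. d \<in> D \<Longrightarrow> g d \<in> lin_span E f"
  shows "card D \<le> card E"
proof -
  interpret K: vector_space "\<lambda>a (p :: ('x, 'k::field) mpoly). cst a * p"
    by (rule vector_space_cst)
  have inj: "inj_on g D"
  proof (rule inj_onI, rule ccontr)
    fix a b assume ab: "a \<in> D" "b \<in> D" "g a = g b" "a \<noteq> b"
    define c where "c d = (if d = a then 1 else if d = b then - 1 else 0 :: 'k)" for d
    have "(\<Sum>d\<in>D. cst (c d) * g d) = (\<Sum>d\<in>{a, b}. cst (c d) * g d)"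
      using fin ab by (intro sum.mono_neutral_right) (auto simp: c_def)
    also have "\<dots> = 0"
      using ab by (simp add: c_def single_uminus)
    finally have "c a = 0"
      using indep ab(1) by (auto simp: lin_indep_def)
    then show False by (simp add: c_def)
  qed
  have "K.independent (g ` D)"
  proof
    assume "K.dependent (g ` D)"
    then obtain u where u: "\<exists>v\<in>g ` D. u v \<noteq> 0" "(\<Sum>v\<in>g ` D. cst (u v) * v) = 0"
      using K.dependent_finite[of "g ` D"] fin(1) by auto
    then have "(\<Sum>d\<in>D. cst (u (g d)) * g d) = 0"
      by (simp add: sum.reindex[OF inj])
    with u(1) indep show False
      unfolding lin_indep_def by fastforce
  qed
  moreover have "g ` D \<subseteq> K.span (f ` E)"
  proof
    fix p assume "p \<in> g ` D"
    then have "p \<in> lin_span E f" using span by auto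
    then obtain c where "p = (\<Sum>e\<in>E. cst (c e) * f e)" by (auto simp: lin_span_def)
    then show "p \<in> K.span (f ` E)"
      by (simp add: K.span_sum K.span_scale K.span_base)
  qed
  ultimately have "card (g ` D) \<le> card (f ` E)"
    using K.independent_span_bound[of "f ` E" "g ` D"] fin(2) by auto
  then show ?thesis
    using card_image[OF inj] card_image_le[OF fin(2), of f] by simp
qed

lemma cst_mult_cst_mult: "cst a * (cst b * p) = cst (b * a) * p"
  unfolding mult.assoc[symmetric] mult_single by (simp add: mult.commute[of a b])

lemma cst_sum: "cst (\<Sum>i\<in>A. c i) = (\<Sum>i\<in>A. cst (c i))"
  by (induction A rule: infinite_finite_induct) (auto simp: single_add)

lemma homogeneous_sum: "(\<And>i. i \<in> A \<Longrightarrow> homogeneous d (p i)) \<Longrightarrow> homogeneous d (sum p A)"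
  by (induction A rule: infinite_finite_induct) (auto intro: homogeneous_add)

section \<open>The linear strand of a minimal resolution\<close>

definition unit_vec :: "nat \<Rightarrow> nat \<Rightarrow> ('x, 'k::field) mpoly"
  where "unit_vec l k = (if k = l then 1 else 0)"

lemma unit_vec_in_free_mod: "l < r \<Longrightarrow> unit_vec l \<in> free_mod X r"
  by (auto simp: unit_vec_def free_mod_def poly_ring_one poly_ring_zero)

lemma diff_map_unit_vec:
  "k < rk F (i - 1) \<Longrightarrow> l < rk F i \<Longrightarrow> diff_map F i (unit_vec l) k = diff F i k l"
  by (simp add: diff_map_def unit_vec_def if_distrib[of "\<lambda>z. _ * z"] cong: if_cong)

locale minimal_resolution =
  fixes X :: "'x set" and J :: "('x, 'k::field) mpoly set" and F :: "('x, 'k) free_complex"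
  assumes ideal: "homogeneous_ideal X J" and irrelevant: "J \<subseteq> irrelevant_ideal X"
    and resolution: "minimal_graded_free_resolution X J F"
begin

lemma graded_aug: "k < rk F 0 \<Longrightarrow> aug F k \<in> poly_ring X" "k < rk F 0 \<Longrightarrow> homogeneous (shift F 0 k) (aug F k)"
  using resolution
  by (auto simp: minimal_graded_free_resolution_def graded_free_resolution_def graded_free_complex_def)

lemma graded_diff:
  assumes "1 \<le> i" "k < rk F (i - 1)" "l < rk F i"
  shows "diff F i k l \<in> poly_ring X" "homogeneous (shift F i l - shift F (i - 1) k) (diff F i k l)"
  using resolution assms
  by (auto simp: minimal_graded_free_resolution_def graded_free_resolution_def graded_free_complex_def)

lemma exact_S: "p \<in> poly_ring X \<Longrightarrow> \<exists>f\<in>chain_mod X F 0. p - aug_map F f \<in> J"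
  using resolution by (auto simp: minimal_graded_free_resolution_def graded_free_resolution_def)

lemma exact_0: "{f \<in> chain_mod X F 0. aug_map F f \<in> J} = diff_map F 1 ` chain_mod X F 1"
  using resolution by (auto simp: minimal_graded_free_resolution_def graded_free_resolution_def)

lemma exact: "1 \<le> i \<Longrightarrow>
    {f \<in> chain_mod X F i. diff_map F i f = (\<lambda>_. 0)} = diff_map F (i + 1) ` chain_mod X F (i + 1)"
  using resolution by (auto simp: minimal_graded_free_resolution_def graded_free_resolution_def)

lemma minimal:
  "1 \<le> i \<Longrightarrow> f \<in> chain_mod X F i \<Longrightarrow> k < rk F (i - 1) \<Longrightarrow> coef (diff_map F i f k) 0 = 0"
  using resolution by (auto simp: minimal_graded_free_resolution_def irrelevant_ideal_def)

text \<open>A cycle is a boundary by exactness, and boundaries have coordinates in the irrelevant ideal.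
  In particular no basis vector is a cycle.\<close>

lemma cycle_coef_0:
  assumes "1 \<le> i" "f \<in> chain_mod X F i" "diff_map F i f = (\<lambda>_. 0)" "k < rk F i"
  shows "coef (f k) 0 = 0"
proof -
  have "f \<in> diff_map F (i + 1) ` chain_mod X F (i + 1)"
    using exact[OF assms(1)] assms(2,3) by blast
  then show ?thesis
    using minimal[of "i + 1"] assms(4) by auto
qed

lemma diff_coef_0:
  assumes "1 \<le> i" "k < rk F (i - 1)" "l < rk F i" shows "coef (diff F i k l) 0 = 0"
  using minimal[OF assms(1) unit_vec_in_free_mod assms(2), of l] assms
  by (simp add: diff_map_unit_vec)

text \<open>Every generator has a larger degree than some generator of the previous module: its image is
  nonzero by \<open>cycle_coef_0\<close>, and a nonzero entry of the matrix has positive degree because nonzero scalars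
  are excluded.\<close>

lemma nonzero_entry:
  assumes "1 \<le> i" "l < rk F i"
  obtains k where "k < rk F (i - 1)" "diff F i k l \<noteq> 0" "shift F (i - 1) k < shift F i l"
proof -
  have "\<exists>k<rk F (i - 1). diff F i k l \<noteq> 0"
  proof (rule ccontr)
    assume "\<not> ?thesis"
    then have "diff_map F i (unit_vec l) k = 0" for k
      by (cases "k < rk F (i - 1)") (simp_all add: diff_map_unit_vec assms, simp add: diff_map_def)
    then have "diff_map F i (unit_vec l) = (\<lambda>_. 0)" by auto
    from cycle_coef_0[OF assms(1) unit_vec_in_free_mod[OF assms(2)] this assms(2)]
    show False by (simp add: unit_vec_def)
  qed
  then obtain k where k: "k < rk F (i - 1)" "diff F i k l \<noteq> 0" by blast
  have "\<not> shift F i l - shift F (i - 1) k \<le> 0"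
    using homogeneous_nonpos[OF graded_diff(2)[OF assms(1) k(1) assms(2)]] k
      diff_coef_0[OF assms(1) k(1) assms(2)] by auto
  with k show thesis by (intro that) auto
qed

text \<open>Some generator of \<open>F\<^sub>0\<close> maps to a nonzero scalar, because 1 is in the image modulo \<open>J\<close>. Any other
  generator could be corrected by a multiple of that one to lie in the kernel, against minimality.\<close>

lemma augmentation:
  shows "rk F 0 = 1" "shift F 0 0 = 0" "\<exists>a. a \<noteq> 0 \<and> aug F 0 = cst a"
proof -
  obtain f where f: "f \<in> chain_mod X F 0" "1 - aug_map F f \<in> J"
    using exact_S[OF poly_ring_one] by blast
  then have "coef (1 - aug_map F f) 0 = 0"
    using irrelevant by (auto simp: irrelevant_ideal_def)
  then have "(\<Sum>k<rk F 0. coef (aug F k) 0 * coef (f k) 0) = 1"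
    by (simp add: lookup_minus aug_map_def lookup_sum coef_mult_0)
  then obtain k0 where k0: "k0 < rk F 0" "coef (aug F k0) 0 \<noteq> 0"
    by (metis (no_types, lifting) lessThan_iff mult_zero_left sum.neutral zero_neq_one)
  define a where "a = coef (aug F k0) 0"
  have shift: "shift F 0 k0 = 0"
    using homogeneous_coef_0[OF graded_aug(2)[OF k0(1)]] k0(2) by blast
  have a: "aug F k0 = cst a" "a \<noteq> 0"
    using homogeneous_nonpos[OF graded_aug(2)[OF k0(1)]] shift k0(2) by (simp_all add: a_def)
  have "l = k0" if l: "l < rk F 0" for l
  proof (rule ccontr)
    assume "l \<noteq> k0"
    define h where "h k = (if k = l then 1 else if k = k0 then - (aug F l * cst (inverse a)) else 0)" for k
    have "h \<in> chain_mod X F 0"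
      using l k0(1) graded_aug(1)[OF l]
      by (auto simp: free_mod_def h_def poly_ring_one poly_ring_zero
          intro!: poly_ring_uminus poly_ring_mult cst_in_poly_ring)
    moreover have "aug_map F h = (\<Sum>k\<in>{l, k0}. aug F k * h k)"
      unfolding aug_map_def using l k0(1) by (intro sum.mono_neutral_right) (auto simp: h_def)
    then have "aug_map F h = aug F l - aug F l * (cst a * cst (inverse a))"
      using \<open>l \<noteq> k0\<close> by (simp add: h_def a(1) mult.left_commute)
    then have "aug_map F h \<in> J"
      using ideal a(2) by (simp add: mult_single homogeneous_ideal_def)
    ultimately have "h \<in> diff_map F 1 ` chain_mod X F 1"
      using exact_0 by blast
    then have "coef (h l) 0 = 0"
      using minimal[of 1] l by auto
    then show False by (simp add: h_def)
  qed note unique = this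
  have k0_0: "k0 = 0" using unique[of 0] k0(1) by auto
  have rk: "\<not> 1 < rk F 0" using unique[of 1] unique[of 0] by auto
  show "rk F 0 = 1" "shift F 0 0 = 0" "\<exists>a. a \<noteq> 0 \<and> aug F 0 = cst a"
    using k0(1) shift a rk unfolding k0_0 by auto
qed

lemma cst_mult_in_ideal: "p \<in> J \<Longrightarrow> cst a * p \<in> J"
  using ideal by (simp add: homogeneous_ideal_def cst_in_poly_ring)

text \<open>Up to a nonzero scalar the augmentation is the projection from \<open>S\<close> to \<open>S/J\<close>, so exactness at \<open>F\<^sub>0\<close> says
  that the only row of the first matrix generates \<open>J\<close>.\<close>

lemma ideal_generated_by_first_matrix: "J = {(\<Sum>k<rk F 1. diff F 1 0 k * f k) | f. f \<in> chain_mod X F 1}"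
proof -
  obtain a where a: "a \<noteq> 0" "aug F 0 = cst a" using augmentation(3) by blast
  have aug: "aug_map F h = cst a * h 0" for h
    by (simp add: aug_map_def augmentation(1) a)
  have d: "diff_map F 1 f 0 = (\<Sum>k<rk F 1. diff F 1 0 k * f k)" for f
    by (simp add: diff_map_def augmentation(1))
  show ?thesis
  proof (intro equalityI subsetI)
    fix p assume p: "p \<in> J"
    define h where "h k = (if k = 0 then p else 0)" for k :: nat
    have "h \<in> chain_mod X F 0"
      using p ideal by (auto simp: h_def free_mod_def augmentation(1) homogeneous_ideal_def)
    moreover have "aug_map F h \<in> J"
      using cst_mult_in_ideal[OF p] by (simp add: aug h_def)
    ultimately obtain f where f: "f \<in> chain_mod X F 1" "h = diff_map F 1 f"
      using exact_0 by blast
    have "p = diff_map F 1 f 0"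
      using fun_cong[OF f(2), of 0] by (simp add: h_def)
    then show "p \<in> {(\<Sum>k<rk F 1. diff F 1 0 k * f k) | f. f \<in> chain_mod X F 1}"
      using f(1) unfolding d by blast
  next
    fix p assume "p \<in> {(\<Sum>k<rk F 1. diff F 1 0 k * f k) | f. f \<in> chain_mod X F 1}"
    then obtain f where f: "f \<in> chain_mod X F 1" "p = diff_map F 1 f 0"
      unfolding d by blast
    then have "cst a * p \<in> J"
      using exact_0 by (auto simp: aug)
    then have "cst (inverse a) * (cst a * p) \<in> J"
      by (rule cst_mult_in_ideal)
    then show "p \<in> J"
      using a(1) by (simp add: mult_single flip: mult.assoc)
  qed
qed

lemma first_matrix_in_ideal:
  assumes "k < rk F 1" shows "diff F 1 0 k \<in> J"
proof -
  have "(\<Sum>j<rk F 1. diff F 1 0 j * unit_vec k j) = diff F 1 0 k"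
    using assms by (simp add: unit_vec_def if_distrib[of "\<lambda>z. _ * z"] cong: if_cong)
  then show ?thesis
    using unit_vec_in_free_mod[OF assms, of X] unfolding ideal_generated_by_first_matrix
    by (intro CollectI exI[of _ "unit_vec k"]) simp
qed

lemma homogeneous_first_matrix: "k < rk F 1 \<Longrightarrow> homogeneous (shift F 1 k) (diff F 1 0 k)"
  using graded_diff(2)[of 1 0 k] augmentation by simp

lemma first_matrix_nonzero: "k < rk F 1 \<Longrightarrow> diff F 1 0 k \<noteq> 0"
  by (rule nonzero_entry[of 1 k]) (auto simp: augmentation(1))

end

text \<open>The homological degree 1 is written as a numeral below, so \<open>Suc 0\<close> is rewritten to it.\<close>

declare One_nat_def [simp del] One_nat_def [symmetric, simp]

text \<open>The linear strand depends on \<open>J\<close> only through its quadrics and the linear syzygies between them. These are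
  the conditions under which it stops after the first step.\<close>

locale quadric_ideal_resolution = minimal_resolution X J F
  for X :: "'x set" and J :: "('x, 'k::field) mpoly set" and F :: "('x, 'k) free_complex" +
  fixes E :: "'e set" and f :: "'e \<Rightarrow> ('x, 'k) mpoly"
  assumes degree_ge_2: "p \<in> J \<Longrightarrow> m \<in> supp p \<Longrightarrow> 2 \<le> mdeg m"
    and finite_E: "finite E"
    and quadrics_in_J: "e \<in> E \<Longrightarrow> f e \<in> J"
    and homogeneous_quadric: "e \<in> E \<Longrightarrow> homogeneous 2 (f e)"
    and quadrics_span: "p \<in> J \<Longrightarrow> homogeneous 2 p \<Longrightarrow> p \<in> lin_span E f"
    and quadrics_indep: "lin_indep E f"
    and no_linear_syzygies: "\<lbrakk>\<And>e. e \<in> E \<Longrightarrow> l e \<in> poly_ring X; \<And>e. e \<in> E \<Longrightarrow> homogeneous 1 (l e);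
      (\<Sum>e\<in>E. l e * f e) = 0; e \<in> E\<rbrakk> \<Longrightarrow> l e = 0"
begin

definition quadric_columns :: "nat set"
  where "quadric_columns = {k. k < rk F 1 \<and> shift F 1 k = 2}"

lemma quadric_columns: "finite quadric_columns" "k \<in> quadric_columns \<Longrightarrow> k < rk F 1"
  by (auto simp: quadric_columns_def)

lemma shift_1_ge_2: assumes "k < rk F 1" shows "2 \<le> shift F 1 k"
proof -
  obtain m where m: "m \<in> supp (diff F 1 0 k)"
    using supp_nonempty[OF first_matrix_nonzero[OF assms]] by blast
  then have "2 \<le> mdeg m"
    using degree_ge_2 first_matrix_in_ideal[OF assms] by blast
  moreover have "int (mdeg m) = shift F 1 k"
    using homogeneous_first_matrix[OF assms] m by (simp add: homogeneous_def)
  ultimately show ?thesis by simp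
qed

lemma quadric_columns_indep: "lin_indep quadric_columns (diff F 1 0)"
  unfolding lin_indep_def
proof (intro allI impI ballI)
  fix c k assume c: "(\<Sum>k\<in>quadric_columns. cst (c k) * diff F 1 0 k) = 0" and k: "k \<in> quadric_columns"
  define h :: "nat \<Rightarrow> ('x, 'k) mpoly" where "h k = (if k \<in> quadric_columns then cst (c k) else 0)" for k
  have "h \<in> chain_mod X F 1"
    using quadric_columns(2) by (force simp: free_mod_def h_def cst_in_poly_ring poly_ring_zero)
  moreover have "(\<Sum>k<rk F 1. diff F 1 0 k * h k) = (\<Sum>k\<in>quadric_columns. diff F 1 0 k * h k)"
    using quadric_columns(2) by (intro sum.mono_neutral_right) (auto simp: h_def)
  then have "(\<Sum>k<rk F 1. diff F 1 0 k * h k) = 0"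
    using c by (simp add: h_def mult.commute)
  then have "diff_map F 1 h = (\<lambda>_. 0)"
    by (auto simp: diff_map_def augmentation(1))
  ultimately have "coef (h k) 0 = 0"
    using cycle_coef_0[of 1 h k] quadric_columns(2)[OF k] by simp
  then show "c k = 0" using k by (simp add: h_def)
qed

text \<open>Write \<open>f e\<close> as a combination of the columns and take the part of degree 2: the columns of degree
  above 2 drop out, and those of degree 2 keep only the constant terms of their coefficients.\<close>

lemma quadric_in_span_of_columns:
  assumes e: "e \<in> E" shows "f e \<in> lin_span quadric_columns (diff F 1 0)"
proof -
  obtain h where h: "f e = (\<Sum>k<rk F 1. diff F 1 0 k * h k)"
    using quadrics_in_J[OF e] ideal_generated_by_first_matrix by auto
  have "f e = hpart 2 (f e)"
    using hpart_homogeneous[OF homogeneous_quadric[OF e]] by simp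
  also have "\<dots> = (\<Sum>k<rk F 1. hpart 2 (diff F 1 0 k * h k))"
    unfolding h by (rule hpart_sum)
  also have "\<dots> = (\<Sum>k<rk F 1. diff F 1 0 k * hpart (2 - shift F 1 k) (h k))"
    by (intro sum.cong refl hpart_mult homogeneous_first_matrix) simp
  also have "\<dots> = (\<Sum>k\<in>quadric_columns. diff F 1 0 k * hpart (2 - shift F 1 k) (h k))"
  proof (intro sum.mono_neutral_right ballI)
    fix k assume "k \<in> {..<rk F 1} - quadric_columns"
    then have "2 - shift F 1 k < 0"
      using shift_1_ge_2[of k] by (auto simp: quadric_columns_def)
    then show "diff F 1 0 k * hpart (2 - shift F 1 k) (h k) = 0"
      using homogeneous_negative[OF homogeneous_hpart, of "2 - shift F 1 k" "h k"] by simp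
  qed (use quadric_columns(2) in auto)
  also have "\<dots> = (\<Sum>k\<in>quadric_columns. cst (coef (h k) 0) * diff F 1 0 k)"
    by (intro sum.cong) (auto simp: quadric_columns_def hpart_zero_degree mult.commute)
  finally show ?thesis by (auto simp: lin_span_def)
qed

lemma column_in_span_of_quadrics: "k \<in> quadric_columns \<Longrightarrow> diff F 1 0 k \<in> lin_span E f"
  using quadrics_span[OF first_matrix_in_ideal] homogeneous_first_matrix[of k]
  by (simp add: quadric_columns_def)

lemma card_quadric_columns: "card quadric_columns = card E"
  using lin_indep_card_le[OF quadric_columns(1) finite_E quadric_columns_indep column_in_span_of_quadrics]
    lin_indep_card_le[OF finite_E quadric_columns(1) quadrics_indep quadric_in_span_of_columns]
  by simp

text \<open>A generator of degree 3 of \<open>F\<^sub>2\<close> gives linear forms \<open>c k\<close> with \<open>\<Sum> g\<^sub>k c k = 0\<close>, where \<open>g\<^sub>k\<close> runs over the quadrics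
  among the generators of \<open>J\<close>; its entries in rows of higher degree are scalars, hence 0. Expressing
  \<open>g\<^sub>k = \<Sum> A k e f\<^sub>e\<close> turns this into a linear syzygy \<open>L\<close> of the \<open>f\<^sub>e\<close>, so \<open>L = 0\<close>. Comparing coefficients of a
  monomial \<open>m\<close>, the scalars \<open>coef (c k) m\<close> are a linear relation between the \<open>g\<^sub>k\<close>, so they vanish as well. But a
  generator with image 0 contradicts \<open>nonzero_entry\<close>.\<close>

lemma shift_2_ge_4: assumes l: "l < rk F 2" shows "4 \<le> shift F 2 l"
proof (rule ccontr)
  assume "\<not> 4 \<le> shift F 2 l"
  obtain k0 where k0: "k0 < rk F 1" "diff F 2 k0 l \<noteq> 0" "shift F 1 k0 < shift F 2 l"
    by (rule nonzero_entry[of 2 l]) (use l in auto)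
  have s: "shift F 2 l = 3"
    using k0(3) shift_1_ge_2[OF k0(1)] \<open>\<not> 4 \<le> shift F 2 l\<close> by simp
  define c where "c k = diff F 2 k l" for k
  have c_hom: "homogeneous (3 - shift F 1 k) (c k)" "c k \<in> poly_ring X" if "k < rk F 1" for k
    using graded_diff[of 2 k l] that l s by (simp_all add: c_def)
  have c_zero: "c k = 0" if "k < rk F 1" "k \<notin> quadric_columns" for k
  proof -
    have "3 - shift F 1 k \<le> 0"
      using shift_1_ge_2[OF that(1)] that by (auto simp: quadric_columns_def)
    then show ?thesis
      using homogeneous_nonpos[OF c_hom(1)[OF that(1)]] diff_coef_0[of 2 k l] that l by (simp add: c_def)
  qed
  have "diff_map F 2 (unit_vec l) \<in> {f \<in> chain_mod X F 1. diff_map F 1 f = (\<lambda>_. 0)}"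
    unfolding exact[OF order_refl] one_add_one using unit_vec_in_free_mod[OF l] by (rule imageI)
  then have "0 = diff_map F 1 (diff_map F 2 (unit_vec l)) 0"
    by simp
  also have "\<dots> = (\<Sum>k<rk F 1. diff F 1 0 k * c k)"
    using l diff_map_unit_vec[of _ F 2 l] by (simp add: diff_map_def[of F 1] augmentation(1) c_def)
  also have "\<dots> = (\<Sum>k\<in>quadric_columns. diff F 1 0 k * c k)"
    using quadric_columns(2) c_zero by (intro sum.mono_neutral_right) auto
  finally have rel: "(\<Sum>k\<in>quadric_columns. diff F 1 0 k * c k) = 0" by simp
  have "\<forall>k\<in>quadric_columns. \<exists>A. diff F 1 0 k = (\<Sum>e\<in>E. cst (A e) * f e)"
    using column_in_span_of_quadrics by (auto simp: lin_span_def)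
  from bchoice[OF this]
  obtain A where "\<forall>k\<in>quadric_columns. diff F 1 0 k = (\<Sum>e\<in>E. cst (A k e) * f e)" ..
  then have A: "diff F 1 0 k = (\<Sum>e\<in>E. cst (A k e) * f e)" if "k \<in> quadric_columns" for k
    using that by (rule bspec)
  define L where "L e = (\<Sum>k\<in>quadric_columns. cst (A k e) * c k)" for e
  have "(\<Sum>e\<in>E. L e * f e) = (\<Sum>e\<in>E. \<Sum>k\<in>quadric_columns. cst (A k e) * c k * f e)"
    by (simp only: L_def sum_distrib_right)
  also have "\<dots> = (\<Sum>k\<in>quadric_columns. \<Sum>e\<in>E. cst (A k e) * c k * f e)"
    by (rule sum.swap)
  also have "\<dots> = (\<Sum>k\<in>quadric_columns. diff F 1 0 k * c k)"
    by (intro sum.cong refl) (simp add: A sum_distrib_left mult_ac)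
  finally have L_rel: "(\<Sum>e\<in>E. L e * f e) = 0" using rel by simp
  have L_in: "L e \<in> poly_ring X" for e
    unfolding L_def
  proof (rule poly_ring_sum)
    fix k assume "k \<in> quadric_columns"
    then show "cst (A k e) * c k \<in> poly_ring X"
      by (intro poly_ring_mult cst_in_poly_ring c_hom(2) quadric_columns(2))
  qed
  have L_hom: "homogeneous 1 (L e)" for e
    unfolding L_def
  proof (rule homogeneous_sum)
    fix k assume "k \<in> quadric_columns"
    then show "homogeneous 1 (cst (A k e) * c k)"
      using homogeneous_mult[OF homogeneous_cst c_hom(1)[of k]] by (simp add: quadric_columns_def)
  qed
  have L0: "L e = 0" if "e \<in> E" for e
    by (rule no_linear_syzygies[of L, OF L_in L_hom L_rel that])
  have "c k0 = 0"
  proof (rule poly_mapping_eqI)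
    fix m
    have coef0: "(\<Sum>k\<in>quadric_columns. A k e * coef (c k) m) = 0" if "e \<in> E" for e
      using arg_cong[OF L0[OF that], of "\<lambda>p. coef p m"] by (simp add: L_def lookup_sum)
    have "(\<Sum>k\<in>quadric_columns. cst (coef (c k) m) * diff F 1 0 k)
        = (\<Sum>k\<in>quadric_columns. \<Sum>e\<in>E. cst (coef (c k) m) * (cst (A k e) * f e))"
      by (simp add: A sum_distrib_left)
    also have "\<dots> = (\<Sum>e\<in>E. \<Sum>k\<in>quadric_columns. cst (A k e * coef (c k) m) * f e)"
      by (subst sum.swap) (simp only: cst_mult_cst_mult)
    also have "\<dots> = (\<Sum>e\<in>E. cst (\<Sum>k\<in>quadric_columns. A k e * coef (c k) m) * f e)"
      by (simp only: cst_sum sum_distrib_right)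
    also have "\<dots> = 0"
      using coef0 by simp
    finally have "\<forall>k\<in>quadric_columns. coef (c k) m = 0"
      using quadric_columns_indep[unfolded lin_indep_def, rule_format, of "\<lambda>k. coef (c k) m"] by blast
    then show "coef (c k0) m = coef 0 m"
      using c_zero[OF k0(1)] by (cases "k0 \<in> quadric_columns") auto
  qed
  with k0(2) show False by (simp add: c_def)
qed

lemma shift_ge: "2 \<le> i \<Longrightarrow> l < rk F i \<Longrightarrow> int i + 2 \<le> shift F i l"
proof (induction i arbitrary: l rule: dec_induct)
  case base
  then show ?case using shift_2_ge_4 by simp
next
  case (step i)
  obtain k where "k < rk F i" "shift F i k < shift F (Suc i) l"
    by (rule nonzero_entry[of "Suc i" l]) (use step in auto)
  with step.IH[of k] show ?case by simp
qed

lemma linear_strand: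
  assumes "1 \<le> i"
  shows "card {k. k < rk F i \<and> shift F i k = int i + 1} = (if i = 1 then card E else 0)"
proof (cases "i = 1")
  case True
  then show ?thesis using card_quadric_columns by (simp add: quadric_columns_def)
next
  case False
  then have "{k. k < rk F i \<and> shift F i k = int i + 1} = {}"
    using shift_ge[of i] assms by fastforce
  then show ?thesis using False by simp
qed

end

section \<open>Ideals generated by quadrics\<close>

lemma ideal_gen_finite:
  assumes "finite B"
  shows "ideal_gen X B = {(\<Sum>b\<in>B. c b * b) | c. \<forall>b\<in>B. c b \<in> poly_ring X}"
proof (intro equalityI subsetI)
  fix p assume "p \<in> ideal_gen X B"
  then obtain A c where A: "p = (\<Sum>b\<in>A. c b * b)" "A \<subseteq> B" "\<forall>b\<in>A. c b \<in> poly_ring X"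
    unfolding ideal_gen_def by blast
  define c' where "c' b = (if b \<in> A then c b else 0)" for b
  have "(\<Sum>b\<in>B. c' b * b) = (\<Sum>b\<in>A. c' b * b)"
    using assms A(2) by (intro sum.mono_neutral_right) (auto simp: c'_def)
  then have "p = (\<Sum>b\<in>B. c' b * b)"
    by (simp add: A(1) c'_def)
  moreover have "\<forall>b\<in>B. c' b \<in> poly_ring X"
    using A(3) by (simp add: c'_def poly_ring_zero)
  ultimately show "p \<in> {(\<Sum>b\<in>B. c b * b) | c. \<forall>b\<in>B. c b \<in> poly_ring X}" by blast
next
  fix p assume "p \<in> {(\<Sum>b\<in>B. c b * b) | c. \<forall>b\<in>B. c b \<in> poly_ring X}"
  then show "p \<in> ideal_gen X B"
    unfolding ideal_gen_def using assms by blast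
qed

lemma generator_in_ideal_gen:
  assumes "b \<in> B" shows "b \<in> ideal_gen X B"
  unfolding ideal_gen_def
  by (rule CollectI, rule exI[of _ "{b}"], rule exI[of _ "\<lambda>_. 1"]) (use assms in \<open>simp add: poly_ring_one\<close>)

lemma homogeneous_ideal_ideal_gen:
  assumes "finite B" "B \<subseteq> poly_ring X" and hom: "\<And>b. b \<in> B \<Longrightarrow> homogeneous d b"
  shows "homogeneous_ideal X (ideal_gen X B)"
  unfolding homogeneous_ideal_def ideal_gen_finite[OF assms(1)]
proof (intro conjI ballI allI subsetI)
  let ?J = "{(\<Sum>b\<in>B. c b * b) | c. \<forall>b\<in>B. c b \<in> poly_ring X}"
  show "p \<in> poly_ring X" if "p \<in> ?J" for p
    using that assms(2) by (auto intro!: poly_ring_sum poly_ring_mult)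
  show "0 \<in> ?J"
    by (rule CollectI, rule exI[of _ "\<lambda>_. 0"]) (simp add: poly_ring_zero)
  show "p + q \<in> ?J" if pq: "p \<in> ?J" "q \<in> ?J" for p q
  proof -
    obtain c d where "p = (\<Sum>b\<in>B. c b * b)" "\<forall>b\<in>B. c b \<in> poly_ring X"
      "q = (\<Sum>b\<in>B. d b * b)" "\<forall>b\<in>B. d b \<in> poly_ring X"
      using pq by blast
    then show ?thesis
      by (intro CollectI exI[of _ "\<lambda>b. c b + d b"]) (simp add: poly_ring_add sum.distrib distrib_right)
  qed
  show "a * p \<in> ?J" if a: "a \<in> poly_ring X" and p: "p \<in> ?J" for a p
  proof -
    obtain c where "p = (\<Sum>b\<in>B. c b * b)" "\<forall>b\<in>B. c b \<in> poly_ring X"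
      using p by blast
    then show ?thesis using a
      by (intro CollectI exI[of _ "\<lambda>b. a * c b"]) (simp add: poly_ring_mult sum_distrib_left mult.assoc)
  qed
  show "hpart e p \<in> ?J" if p: "p \<in> ?J" for p e
  proof -
    obtain c where c: "p = (\<Sum>b\<in>B. c b * b)" "\<forall>b\<in>B. c b \<in> poly_ring X"
      using p by blast
    have "hpart e p = (\<Sum>b\<in>B. hpart e (b * c b))"
      unfolding c(1) hpart_sum by (simp only: mult.commute)
    also have "\<dots> = (\<Sum>b\<in>B. hpart (e - d) (c b) * b)"
      using hpart_mult[OF hom] by (intro sum.cong) (simp_all add: mult.commute)
    finally show ?thesis
      using c(2) by (intro CollectI exI[of _ "\<lambda>b. hpart (e - d) (c b)"]) (simp add: hpart_in_poly_ring)
  qed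
qed

lemma ideal_gen_degree_ge:
  assumes "p \<in> ideal_gen X B" and hom: "\<And>b. b \<in> B \<Longrightarrow> homogeneous d b" and m: "m \<in> supp p"
  shows "d \<le> int (mdeg m)"
proof -
  obtain A c where A: "p = (\<Sum>b\<in>A. c b * b)" "A \<subseteq> B"
    using assms(1) unfolding ideal_gen_def by blast
  then obtain b where b: "b \<in> A" "m \<in> supp (c b * b)"
    using m Poly_Mapping.keys_sum[of "\<lambda>b. c b * b" A] by blast
  obtain m1 m2 where "m = m1 + m2" "m2 \<in> supp b"
    using keys_mult[of "c b" b] b(2) by blast
  then show ?thesis
    using hom[of b] A(2) b(1) by (auto simp: homogeneous_def mdeg_add)
qed

text \<open>In the degree of the generators only the constant terms of the coefficients contribute.\<close>

lemma ideal_gen_initial_degree: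
  assumes "p \<in> ideal_gen X B" "homogeneous d p" and hom: "\<And>b. b \<in> B \<Longrightarrow> homogeneous d b" "finite B"
  shows "p \<in> lin_span B (\<lambda>b. b)"
proof -
  obtain c where c: "p = (\<Sum>b\<in>B. c b * b)"
    using assms(1) unfolding ideal_gen_finite[OF \<open>finite B\<close>] by blast
  have "p = hpart d p"
    using hpart_homogeneous[OF assms(2)] by simp
  also have "\<dots> = (\<Sum>b\<in>B. hpart d (b * c b))"
    unfolding c hpart_sum by (simp only: mult.commute)
  also have "\<dots> = (\<Sum>b\<in>B. cst (coef (c b) 0) * b)"
    using hpart_mult[OF hom(1), of _ d] by (intro sum.cong) (simp_all add: hpart_zero_degree mult.commute)
  finally show ?thesis by (auto simp: lin_span_def)
qed

section \<open>Edge binomials of a triangle-free graph\<close>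

definition edge_binomial :: "'v \<Rightarrow> 'v \<Rightarrow> ('v xy, 'k::field) mpoly"
  where "edge_binomial a b = var (XVar a) * var (YVar b) - var (XVar b) * var (YVar a)"

text \<open>The exponent vector of \<open>x\<^sub>a y\<^sub>b\<close>.\<close>

definition mixed_monomial :: "'v \<Rightarrow> 'v \<Rightarrow> 'v xy \<Rightarrow>\<^sub>0 nat"
  where "mixed_monomial a b = Poly_Mapping.single (XVar a) 1 + Poly_Mapping.single (YVar b) 1"

lemma edge_binomial_monomials:
  "edge_binomial a b = Poly_Mapping.single (mixed_monomial a b) 1 - Poly_Mapping.single (mixed_monomial b a) 1"
  by (simp add: edge_binomial_def var_def mult_single mixed_monomial_def)

lemma edge_binomial_swap: "edge_binomial b a = - edge_binomial a b"
  by (simp add: edge_binomial_def)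

lemma homogeneous_var: "homogeneous 1 (var x)"
  by (simp add: homogeneous_def var_def)

lemma homogeneous_edge_binomial: "homogeneous 2 (edge_binomial a b)"
proof -
  have "homogeneous 2 (var x * var y)" for x y
    using homogeneous_mult[OF homogeneous_var homogeneous_var, of x y] by simp
  then show ?thesis
    unfolding edge_binomial_def diff_conv_add_uminus
    by (intro homogeneous_add homogeneous_uminus)
qed

lemma var_in_poly_ring: "x \<in> X \<Longrightarrow> var x \<in> poly_ring X"
  by (simp add: poly_ring_def var_def)

lemma edge_binomial_in_poly_ring:
  "a \<in> fst G \<Longrightarrow> b \<in> fst G \<Longrightarrow> edge_binomial a b \<in> poly_ring (edge_vars G)"
  unfolding edge_binomial_def
  by (intro poly_ring_diff poly_ring_mult var_in_poly_ring) (auto simp: edge_vars_def)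

lemma mdeg_1_single:
  assumes "mdeg m = 1" obtains x where "m = Poly_Mapping.single x 1"
proof -
  from assms have "Poly_Mapping.keys m \<noteq> {}"
    by (auto simp: mdeg_def)
  then obtain x where x: "x \<in> Poly_Mapping.keys m" by blast
  then have "1 \<le> Poly_Mapping.lookup m x"
    by (simp add: in_keys_iff)
  then have eq: "m = Poly_Mapping.single x 1 + (m - Poly_Mapping.single x 1)"
    by (intro poly_mapping_eqI) (auto simp: lookup_add minus_poly_mapping.rep_eq lookup_single when_def)
  then have "mdeg (m - Poly_Mapping.single x 1) = 0"
    using assms mdeg_add[of "Poly_Mapping.single x 1" "m - Poly_Mapping.single x 1"] by simp
  then show thesis
    using eq that[of x] by (simp add: mdeg_eq_0_iff)
qed

lemma coef_monomial_mult_not_dvd: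
  assumes "\<And>m'. m \<noteq> c + m'" shows "coef (Poly_Mapping.single c a * p) m = 0"
proof -
  have "m \<notin> supp (Poly_Mapping.single c a * p)"
    using assms by (auto elim!: supp_monomial_mult)
  then show ?thesis by (simp add: in_keys_iff)
qed

text \<open>The case \<open>a = c\<close> only says that \<open>{a}\<close> is not an edge, which holds in a simple graph.\<close>

definition triangle_free :: "'v graph \<Rightarrow> bool"
  where "triangle_free G \<longleftrightarrow> (\<forall>a b c. {a, b} \<in> snd G \<longrightarrow> {b, c} \<in> snd G \<longrightarrow> {a, c} \<notin> snd G)"

lemma triangle_free_far_endpoint:
  assumes "triangle_free G" "e \<in> snd G" "card e = 2"
  obtains a b where "e = {a, b}" "{w, a} \<notin> snd G"
proof -
  obtain a b where e: "e = {a, b}"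
    using assms(3) by (auto simp: card_2_iff)
  show thesis
  proof (cases "{w, a} \<in> snd G")
    case True
    then have "{w, b} \<notin> snd G"
      using assms(1,2) e unfolding triangle_free_def by blast
    then show thesis using that[of b a] e by (simp add: insert_commute)
  next
    case False
    then show thesis using that e by blast
  qed
qed

text \<open>For a variable \<open>v\<close> at the vertex \<open>w\<close>, order the edge \<open>e = {p, q}\<close> so that the endpoint which is not adjacent
  to \<open>w\<close> has its \<open>y\<close>-variable in \<open>x\<^sub>p y\<^sub>q\<close> if \<open>v = x\<^sub>w\<close>, and its \<open>x\<close>-variable if \<open>v = y\<^sub>w\<close>. A monomial \<open>x\<^sub>p\<^sub>' y\<^sub>q\<^sub>'\<close> that
  divides \<open>x\<^sub>p y\<^sub>q v\<close> and differs from \<open>x\<^sub>p y\<^sub>q\<close> involves \<open>v\<close> and that endpoint, so it does not come from an edge.\<close>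

lemma isolating_monomial:
  assumes "triangle_free G" "e \<in> snd G" "card e = 2"
  shows "\<exists>p q. e = {p, q} \<and> (\<forall>p' q' m'. {p', q'} \<in> snd G \<longrightarrow>
    mixed_monomial p q + Poly_Mapping.single v 1 = mixed_monomial p' q' + m' \<longrightarrow> p' = p \<and> q' = q)"
proof -
  define w where "w = (case v of XVar w \<Rightarrow> w | YVar w \<Rightarrow> w)"
  obtain a b where ab: "e = {a, b}" "{w, a} \<notin> snd G"
    using triangle_free_far_endpoint[OF assms] by metis
  have div: "Poly_Mapping.lookup (mixed_monomial p q + Poly_Mapping.single v 1) (XVar p') \<noteq> 0"
    "Poly_Mapping.lookup (mixed_monomial p q + Poly_Mapping.single v 1) (YVar q') \<noteq> 0"
    if "mixed_monomial p q + Poly_Mapping.single v 1 = mixed_monomial p' q' + m'" for p q p' q' m'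
    unfolding that by (simp_all add: lookup_add mixed_monomial_def)
  show ?thesis
  proof (cases v)
    case (XVar u)
    then have w: "w = u" by (simp add: w_def)
    show ?thesis
    proof (rule exI[of _ b], rule exI[of _ a], intro conjI allI impI)
      fix p' q' m' assume *: "{p', q'} \<in> snd G"
        "mixed_monomial b a + Poly_Mapping.single v 1 = mixed_monomial p' q' + m'"
      have "p' = b \<or> p' = w" "q' = a"
        using div[OF *(2)] by (auto simp: lookup_add mixed_monomial_def XVar w lookup_single when_def split: if_splits)
      then show "p' = b" "q' = a" using *(1) ab(2) by auto
    qed (use ab in auto)
  next
    case (YVar u)
    then have w: "w = u" by (simp add: w_def)
    show ?thesis
    proof (rule exI[of _ a], rule exI[of _ b], intro conjI allI impI)
      fix p' q' m' assume *: "{p', q'} \<in> snd G"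
        "mixed_monomial a b + Poly_Mapping.single v 1 = mixed_monomial p' q' + m'"
      have "p' = a" "q' = b \<or> q' = w"
        using div[OF *(2)] by (auto simp: lookup_add mixed_monomial_def YVar w lookup_single when_def split: if_splits)
      then show "p' = a" "q' = b" using *(1) ab(2) by (auto simp: insert_commute)
    qed (use ab in auto)
  qed
qed

text \<open>The generating set of the ideal contains \<open>f\<^sub>e\<close> and \<open>- f\<^sub>e\<close> for every edge. An orientation selects one of them.\<close>

locale oriented_graph =
  fixes G :: "'v graph" and \<alpha> \<beta> :: "'v set \<Rightarrow> 'v"
  assumes simple: "finite_simple_graph G"
    and ends: "e \<in> snd G \<Longrightarrow> e = {\<alpha> e, \<beta> e}"
begin

definition oriented_binomial :: "'v set \<Rightarrow> ('v xy, 'k::field) mpoly"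
  where "oriented_binomial e = edge_binomial (\<alpha> e) (\<beta> e)"

lemma card_edge: "e \<in> snd G \<Longrightarrow> card e = 2"
  using simple by (auto simp: finite_simple_graph_def)

lemma ends_distinct: "e \<in> snd G \<Longrightarrow> \<alpha> e \<noteq> \<beta> e"
proof
  assume e: "e \<in> snd G" and "\<alpha> e = \<beta> e"
  then have "e = {\<alpha> e}" using ends[OF e] by simp
  then have "card e = 1" by (metis is_singletonI is_singleton_altdef)
  then show False using card_edge[OF e] by simp
qed

lemma finite_edges: "finite (snd G)"
  using simple by (auto simp: finite_simple_graph_def intro: finite_subset[of _ "Pow (fst G)"])

lemma finite_edge_vars: "finite (edge_vars G)"
  using simple by (auto simp: finite_simple_graph_def edge_vars_def)

text \<open>If \<open>x\<^sub>p y\<^sub>q m\<close> is divisible by no other monomial \<open>x\<^sub>p\<^sub>' y\<^sub>q\<^sub>'\<close> with \<open>{p', q'}\<close> an edge, it isolates the coefficient of \<open>m\<close> in the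
  factor of the binomial of \<open>{p, q}\<close>; the sign depends on the orientation.\<close>

lemma coef_linear_combination:
  fixes l :: "'v set \<Rightarrow> ('v xy, 'k::field) mpoly"
  assumes e: "{p, q} \<in> snd G" and iso: "\<And>p' q' m'. {p', q'} \<in> snd G \<Longrightarrow>
      mixed_monomial p q + m = mixed_monomial p' q' + m' \<Longrightarrow> p' = p \<and> q' = q"
  shows "coef (\<Sum>e\<in>snd G. l e * oriented_binomial e) (mixed_monomial p q + m)
    = (if \<alpha> {p, q} = p then 1 else - 1) * coef (l {p, q}) m"
proof -
  let ?M = "mixed_monomial p q + m"
  have mono: "coef (Poly_Mapping.single (mixed_monomial p' q') 1 * h) ?M
      = (if p' = p \<and> q' = q then coef h m else 0)" if "{p', q'} \<in> snd G" for p' q' and h :: "('v xy, 'k) mpoly"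
  proof (cases "p' = p \<and> q' = q")
    case True
    then show ?thesis by (simp add: coef_monomial_mult)
  next
    case False
    then have "?M \<noteq> mixed_monomial p' q' + m'" for m'
      using iso[OF that] by blast
    then have "coef (Poly_Mapping.single (mixed_monomial p' q') 1 * h) ?M = 0"
      by (rule coef_monomial_mult_not_dvd)
    then show ?thesis using False by auto
  qed
  have *: "coef (l e * oriented_binomial e) ?M
      = (if \<alpha> e = p \<and> \<beta> e = q then coef (l e) m else 0) - (if \<beta> e = p \<and> \<alpha> e = q then coef (l e) m else 0)"
    if "e \<in> snd G" for e
  proof -
    have "{\<alpha> e, \<beta> e} \<in> snd G" "{\<beta> e, \<alpha> e} \<in> snd G"
      using ends[OF that] that by (simp_all add: insert_commute)
    from mono[OF this(1), of "l e"] mono[OF this(2), of "l e"] show ?thesis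
      by (simp add: oriented_binomial_def edge_binomial_monomials mult.commute[of "l e"] left_diff_distrib lookup_minus)
  qed
  have pq: "p \<noteq> q" using card_edge[OF e] by auto
  have "coef (\<Sum>e\<in>snd G. l e * oriented_binomial e) ?M = (\<Sum>e\<in>snd G. coef (l e * oriented_binomial e) ?M)"
    by (rule lookup_sum)
  also have "\<dots> = (\<Sum>e\<in>{{p, q}}. coef (l e * oriented_binomial e) ?M)"
  proof (intro sum.mono_neutral_right ballI)
    fix e assume e': "e \<in> snd G - {{p, q}}"
    then have "e \<in> snd G" "e \<noteq> {p, q}"
      by auto
    then have "{\<alpha> e, \<beta> e} \<noteq> {p, q}"
      by (simp only: ends[OF \<open>e \<in> snd G\<close>, symmetric] not_False_eq_True)
    then have "\<not> (\<alpha> e = p \<and> \<beta> e = q)" "\<not> (\<beta> e = p \<and> \<alpha> e = q)"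
      by (simp_all add: doubleton_eq_iff) auto
    then show "coef (l e * oriented_binomial e) ?M = 0"
      by (simp only: *[OF \<open>e \<in> snd G\<close>] if_False diff_zero)
  qed (use finite_edges e in auto)
  also have "\<dots> = (if \<alpha> {p, q} = p then 1 else - 1) * coef (l {p, q}) m"
  proof -
    have "\<alpha> {p, q} = p \<and> \<beta> {p, q} = q \<or> \<alpha> {p, q} = q \<and> \<beta> {p, q} = p"
      using iffD1[OF doubleton_eq_iff ends[OF e]] by metis
    then show ?thesis using *[OF e] pq by auto
  qed
  finally show ?thesis .
qed

text \<open>A monomial of the linear form \<open>l e\<close> is a variable \<open>v\<close>. The coefficient of \<open>l e\<close> at \<open>v\<close> is, up to sign, the coefficient
  of the relation at the monomial that isolates \<open>v\<close> and \<open>e\<close>, hence 0.\<close>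

lemma no_linear_syzygies:
  fixes l :: "'v set \<Rightarrow> ('v xy, 'k::field) mpoly"
  assumes "triangle_free G" and hom: "\<And>e. e \<in> snd G \<Longrightarrow> homogeneous 1 (l e)"
    and rel: "(\<Sum>e\<in>snd G. l e * oriented_binomial e) = 0" and e: "e \<in> snd G"
  shows "l e = 0"
proof (rule ccontr)
  assume "l e \<noteq> 0"
  then obtain m where m: "m \<in> supp (l e)" using supp_nonempty by blast
  then have "mdeg m = 1" using hom[OF e] by (auto simp: homogeneous_def)
  then obtain v where v: "m = Poly_Mapping.single v 1" by (rule mdeg_1_single)
  obtain p q where pq: "e = {p, q}" "\<forall>p' q' m'. {p', q'} \<in> snd G \<longrightarrow>
      mixed_monomial p q + Poly_Mapping.single v 1 = mixed_monomial p' q' + m' \<longrightarrow> p' = p \<and> q' = q"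
    using isolating_monomial[OF assms(1) e card_edge[OF e], of v] by (elim exE conjE)
  have "coef (\<Sum>e\<in>snd G. l e * oriented_binomial e) (mixed_monomial p q + m)
      = (if \<alpha> {p, q} = p then 1 else - 1) * coef (l {p, q}) m"
    unfolding v by (rule coef_linear_combination) (use pq e in auto)
  then have "coef (l e) m = 0"
    unfolding rel pq(1) by (auto split: if_splits)
  with m show False by (simp add: in_keys_iff)
qed

text \<open>Multiplied by a variable, a linear relation becomes a linear syzygy.\<close>

lemma binomials_independent:
  assumes "triangle_free G"
  shows "lin_indep (snd G) (oriented_binomial :: _ \<Rightarrow> ('v xy, 'k::field) mpoly)"
  unfolding lin_indep_def
proof (intro allI impI ballI)
  fix c :: "'v set \<Rightarrow> 'k" and e
  assume rel: "(\<Sum>e\<in>snd G. cst (c e) * oriented_binomial e) = 0" and e: "e \<in> snd G"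
  define x :: "'v xy" where "x = XVar (\<alpha> e)"
  have "(\<Sum>e\<in>snd G. (cst (c e) * var x) * oriented_binomial e) = var x * (\<Sum>e\<in>snd G. cst (c e) * oriented_binomial e)"
    by (simp add: sum_distrib_left mult_ac)
  then have "(\<Sum>e\<in>snd G. (cst (c e) * var x) * oriented_binomial e) = 0"
    using rel by simp
  moreover have "homogeneous 1 (cst (c e) * var x)" for e
    using homogeneous_mult[OF homogeneous_cst homogeneous_var] by simp
  ultimately have "cst (c e) * var x = 0"
    using no_linear_syzygies[OF assms, of "\<lambda>e. cst (c e) * var x"] e by blast
  then have "coef (cst (c e) * var x) (Poly_Mapping.single x 1) = 0" by simp
  then show "c e = 0" by (simp add: var_def)
qed

lemma binomial_edge_ideal_generators:
  defines "B \<equiv> {var (XVar a) * var (YVar b) - var (XVar b) * var (YVar a) | a b. {a, b} \<in> snd G} :: ('v xy, 'k::field) mpoly set"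
  shows "finite B" "B \<subseteq> poly_ring (edge_vars G)" "\<And>b. b \<in> B \<Longrightarrow> homogeneous 2 b"
    "oriented_binomial ` snd G \<subseteq> B" "B \<subseteq> lin_span (snd G) oriented_binomial"
proof -
  have B: "B = {edge_binomial a b | a b. {a, b} \<in> snd G}"
    by (simp add: B_def edge_binomial_def)
  have in_V: "a \<in> fst G \<and> b \<in> fst G" if "{a, b} \<in> snd G" for a b
    using simple that unfolding finite_simple_graph_def by blast
  have "B \<subseteq> (\<lambda>(a, b). edge_binomial a b) ` (fst G \<times> fst G)"
  proof
    fix p assume "p \<in> B"
    then obtain a b where "p = edge_binomial a b" "{a, b} \<in> snd G" unfolding B by blast
    then show "p \<in> (\<lambda>(a, b). edge_binomial a b) ` (fst G \<times> fst G)"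
      using in_V[of a b] by (intro image_eqI[of _ _ "(a, b)"]) auto
  qed
  moreover have "finite (fst G \<times> fst G)"
    using simple by (simp add: finite_simple_graph_def)
  ultimately show "finite B" by (rule finite_surj[rotated])
  show "B \<subseteq> poly_ring (edge_vars G)"
    using in_V by (auto simp: B intro!: edge_binomial_in_poly_ring)
  show "homogeneous 2 b" if "b \<in> B" for b
    using that by (auto simp: B homogeneous_edge_binomial)
  show "oriented_binomial ` snd G \<subseteq> B"
  proof
    fix p :: "('v xy, 'k) mpoly" assume "p \<in> oriented_binomial ` snd G"
    then obtain e where e: "e \<in> snd G" "p = edge_binomial (\<alpha> e) (\<beta> e)" by (auto simp: oriented_binomial_def)
    then have "{\<alpha> e, \<beta> e} \<in> snd G" using ends by simp
    with e(2) show "p \<in> B" unfolding B by blast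
  qed
  show "B \<subseteq> lin_span (snd G) oriented_binomial"
  proof
    fix p assume "p \<in> B"
    then obtain a b where ab: "{a, b} \<in> snd G" "p = edge_binomial a b" by (auto simp: B)
    define s :: 'k where "s = (if \<alpha> {a, b} = a then 1 else - 1)"
    have "\<alpha> {a, b} = a \<and> \<beta> {a, b} = b \<or> \<alpha> {a, b} = b \<and> \<beta> {a, b} = a"
      using iffD1[OF doubleton_eq_iff ends[OF ab(1)]] by metis
    then have "p = cst s * oriented_binomial {a, b}"
      using ends_distinct[OF ab(1)] edge_binomial_swap[of a b]
      by (auto simp: ab(2) s_def oriented_binomial_def single_uminus)
    also have "\<dots> = (\<Sum>e\<in>snd G. cst (if e = {a, b} then s else 0) * oriented_binomial e)"
      using finite_edges ab(1) by (simp add: if_distrib[of "\<lambda>z. cst z * _"] cong: if_cong)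
    finally show "p \<in> lin_span (snd G) oriented_binomial" by (auto simp: lin_span_def)
  qed
qed

end

lemma lin_span_trans:
  assumes "p \<in> lin_span B (\<lambda>b. b)" "B \<subseteq> lin_span E f" shows "p \<in> lin_span E f"
proof -
  obtain c where c: "p = (\<Sum>b\<in>B. cst (c b) * b)" using assms(1) by (auto simp: lin_span_def)
  have "\<forall>b\<in>B. \<exists>d. b = (\<Sum>e\<in>E. cst (d e) * f e)" using assms(2) by (auto simp: lin_span_def)
  from bchoice[OF this] obtain d where d: "\<forall>b\<in>B. b = (\<Sum>e\<in>E. cst (d b e) * f e)" ..
  have "p = (\<Sum>b\<in>B. cst (c b) * (\<Sum>e\<in>E. cst (d b e) * f e))"
    unfolding c
  proof (rule sum.cong[OF refl])
    fix b assume "b \<in> B"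
    then show "cst (c b) * b = cst (c b) * (\<Sum>e\<in>E. cst (d b e) * f e)"
      by (intro arg_cong[where f = "(*) (cst (c b))"] bspec[OF d])
  qed
  also have "\<dots> = (\<Sum>e\<in>E. \<Sum>b\<in>B. cst (d b e * c b) * f e)"
    by (subst sum.swap) (simp only: sum_distrib_left cst_mult_cst_mult)
  also have "\<dots> = (\<Sum>e\<in>E. cst (\<Sum>b\<in>B. d b e * c b) * f e)"
    by (simp only: cst_sum sum_distrib_right)
  finally show ?thesis by (auto simp: lin_span_def)
qed

text \<open>The value is the same for every minimal resolution by \<open>linear_strand\<close>, and at least one exists; hence
  the definite description picks it.\<close>

theorem betti_linear_strand_triangle_free:
  fixes G :: "'v graph"
  assumes G: "finite_simple_graph G" "triangle_free G" and i: "1 \<le> i"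
  shows "betti TYPE('k::field) G i (int i + 1) = (if i = 1 then card (snd G) else 0)"
proof -
  have "\<forall>e\<in>snd G. \<exists>ab. e = {fst ab, snd ab}"
  proof
    fix e assume "e \<in> snd G"
    then obtain a b where "e = {a, b}"
      using G(1) by (auto simp: finite_simple_graph_def card_2_iff)
    then show "\<exists>ab. e = {fst ab, snd ab}" by (intro exI[of _ "(a, b)"]) simp
  qed
  from bchoice[OF this] obtain ab where "\<forall>e\<in>snd G. e = {fst (ab e), snd (ab e)}" ..
  then interpret oriented_graph G "\<lambda>e. fst (ab e)" "\<lambda>e. snd (ab e)"
    by (intro oriented_graph.intro G(1)) (rule bspec)
  define J :: "('v xy, 'k) mpoly set" where "J = binomial_edge_ideal G"
  define B :: "('v xy, 'k) mpoly set" where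
    "B = {var (XVar a) * var (YVar b) - var (XVar b) * var (YVar a) | a b. {a, b} \<in> snd G}"
  note B = binomial_edge_ideal_generators[where 'k = 'k, folded B_def]
  have J: "J = ideal_gen (edge_vars G) B"
    by (simp add: J_def binomial_edge_ideal_def B_def)
  have hom: "homogeneous_ideal (edge_vars G) J"
    unfolding J by (rule homogeneous_ideal_ideal_gen[OF B(1-3)])
  have deg: "2 \<le> mdeg m" if "p \<in> J" "m \<in> supp p" for p m
    using ideal_gen_degree_ge[OF that(1)[unfolded J] B(3) that(2)] by simp
  have irr: "J \<subseteq> irrelevant_ideal (edge_vars G)"
  proof
    fix p assume p: "p \<in> J"
    then have "0 \<notin> supp p" using deg[of p 0] by auto
    then show "p \<in> irrelevant_ideal (edge_vars G)"
      using p hom by (auto simp: irrelevant_ideal_def homogeneous_ideal_def in_keys_iff)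
  qed
  have card: "card {k. k < rk F i \<and> shift F i k = int i + 1} = (if i = 1 then card (snd G) else 0)"
    if F: "minimal_graded_free_resolution (edge_vars G) J F" for F
  proof -
    interpret quadric_ideal_resolution "edge_vars G" J F "snd G" oriented_binomial
    proof unfold_locales
      show "p \<in> lin_span (snd G) oriented_binomial" if "p \<in> J" "homogeneous 2 p" for p
        using lin_span_trans[OF ideal_gen_initial_degree[OF that(1)[unfolded J] that(2) B(3) B(1)] B(5)] .
      show "oriented_binomial e \<in> J" if "e \<in> snd G" for e
        using that B(4) generator_in_ideal_gen unfolding J by blast
      show "homogeneous 2 (oriented_binomial e)" for e
        by (simp add: oriented_binomial_def homogeneous_edge_binomial)
      show "l e = 0" if "\<And>e. e \<in> snd G \<Longrightarrow> homogeneous 1 (l e)"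
        "(\<Sum>e\<in>snd G. l e * oriented_binomial e) = 0" "e \<in> snd G" for l :: "'v set \<Rightarrow> ('v xy, 'k) mpoly" and e
        by (rule no_linear_syzygies[OF G(2) that])
    qed (fact hom irr F deg finite_edges binomials_independent[OF G(2)])+
    show ?thesis by (rule linear_strand[OF i])
  qed
  obtain F where F: "minimal_graded_free_resolution (edge_vars G) J F"
    using minimal_resolution_exists[OF finite_edge_vars hom irr] ..
  show ?thesis
    unfolding betti_def graded_betti_def J_def[symmetric]
  proof (rule the_equality)
    show "\<exists>F. minimal_graded_free_resolution (edge_vars G) J F \<and>
        (if i = 1 then card (snd G) else 0) = card {k. k < rk F i \<and> shift F i k = int i + 1}"
      by (intro exI[of _ F] conjI F card[OF F, symmetric])
    show "b = (if i = 1 then card (snd G) else 0)"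
      if "\<exists>F. minimal_graded_free_resolution (edge_vars G) J F \<and>
        b = card {k. k < rk F i \<and> shift F i k = int i + 1}" for b
    proof -
      from that obtain F' where "minimal_graded_free_resolution (edge_vars G) J F'"
        and b: "b = card {k. k < rk F' i \<and> shift F' i k = int i + 1}"
        by (elim exE conjE)
      from card[OF this(1)] show ?thesis unfolding b .
    qed
  qed
qed

section \<open>The bipartite complement of an even cycle\<close>

lemma triangle_free_Gn: "triangle_free (Gn n)"
proof -
  have sides: "a \<in> range U \<longleftrightarrow> b \<notin> range U" if "{a, b} \<in> snd (Gn n)" for a b
    using that by (auto simp: Gn_def doubleton_eq_iff)
  show ?thesis
    unfolding triangle_free_def
  proof (intro allI impI notI)
    fix a b c
    assume "{a, b} \<in> snd (Gn n)" "{b, c} \<in> snd (Gn n)" "{a, c} \<in> snd (Gn n)"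
    from this[THEN sides] show False by satx
  qed
qed

text \<open>Each \<open>u\<^sub>i\<close> misses exactly the vertices \<open>v\<^sub>i\<close> and \<open>v\<^sub>i\<^sub>-\<^sub>1\<close>, which differ since \<open>n\<close> does not divide 1.\<close>

lemma card_edges_Gn:
  assumes "2 \<le> n" shows "card (snd (Gn n)) = n * (n - 2)"
proof -
  define N where "N i = {j. j < n \<and> j \<noteq> i \<and> int j \<noteq> (int i - 1) mod int n}" for i
  have "snd (Gn n) = (\<lambda>(i, j). {U i, V j}) ` (SIGMA i:{..<n}. N i)"
    by (auto simp: Gn_def N_def image_iff)
  moreover have "inj_on (\<lambda>(i, j). {U i, V j}) (SIGMA i:{..<n}. N i)"
    by (auto simp: inj_on_def doubleton_eq_iff)
  ultimately have "card (snd (Gn n)) = card (SIGMA i:{..<n}. N i)"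
    by (simp add: card_image)
  also have "\<dots> = (\<Sum>i<n. card (N i))"
    by (simp add: N_def)
  also have "\<dots> = (\<Sum>i<n. n - 2)"
  proof (rule sum.cong)
    fix i assume "i \<in> {..<n}"
    then have i: "i < n" by simp
    define k where "k = nat ((int i - 1) mod int n)"
    have k: "int k = (int i - 1) mod int n" "k < n"
      using assms by (auto simp: k_def nat_less_iff)
    have "k \<noteq> i"
    proof
      assume "k = i"
      then have "int i mod int n = (int i - 1) mod int n" using k i by simp
      then have "int n dvd 1" by (simp add: mod_eq_dvd_iff)
      then show False using assms by simp
    qed
    have "N i = {..<n} - {i, k}"
      unfolding N_def k(1)[symmetric] by auto
    then show "card (N i) = n - 2"
      using i k(2) \<open>k \<noteq> i\<close> by (simp add: card_Diff_subset)
  qed simp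
  finally show ?thesis by simp
qed

theorem proposition5p1:
  fixes n i :: nat
  assumes "n \<ge> 5" and "i \<ge> 1"
  shows "betti TYPE('k::field) (Gn n) i (int i + 1) = (if i = 1 then n * (n - 2) else 0)"
proof -
  have "card (snd (Gn n)) = n * (n - 2)"
    using assms(1) by (intro card_edges_Gn) simp
  then show ?thesis
    using betti_linear_strand_triangle_free[OF finite_simple_graph_Gn triangle_free_Gn assms(2), of n, where 'k = 'k]
    by (simp only:)
qed

end
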